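(* Let $(W,d)$ be a closed Hilbert complex, let $B:Z\to W^k$, $O:W^k\to Y$ and $R:W^{k-1}\to Y_\sigma$ be bounded linear operators between Hilbert spaces, let $\boldsymbol\Pi:\mathfrak H^k\to\mathbb R^{b_k}$ be an isomorphism, let $Z_{\rm ad}\subset Z$ and $A_{\rm ad}\subset\mathbb R^m$ be nonempty closed convex sets, and let $\alpha>0$, $\alpha_{\rm top}>0$. Then the optimal control problem (P) described in the context has a unique optimal control pair $(z^*,a^* )\in Z_{\rm ad}\times A_{\rm ad}$, and the associated states $(\sigma^*,u^*,p^*,h^* )$ are uniquely determined.
   Context: A Hilbert complex $(W,d)$ consists of real Hilbert spaces $W^k$ and densely defined closed linear operators $d^k:V^k\subset W^k\to W^{k+1}$ with $d^k V^k\subset V^{k+1}$, $d^{k+1}d^k=0$; $V^k$ carries the graph norm. It is closed if every $\operatorname{range}d^{k-1}$ is closed in $W^k$. The harmonic space is $\mathfrak H^k=\ker d^k\cap(\operatorname{range}d^{k-1})^{\perp}$, of finite dimension $b_k$. Superscripts on $d$ are suppressed and $\langle\cdot,\cdot\rangle$ denotes the relevant $W$ inner product. Data: Hilbert spaces $Z,Y,Y_\sigma$; $f\in W^k$, $y_d\in Y$, $r_d\in Y_\sigma$, $\pi_d,c_0\in\mathbb R^{b_k}$, a matrix $G\in\mathbb R^{b_k\times m}$, weights $w_y,w_\sigma,w_\Pi\ge0$. Problem (P): minimize $$J(\sigma,u,h,z,a)=\tfrac{w_y}{2}\|O(u+h)-y_d\|_Y^2+\tfrac{w_\sigma}{2}\|R\sigma-r_d\|_{Y_\sigma}^2+\tfrac{w_\Pi}{2}\|\boldsymbol\Pi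 h-\pi_d\|_{\mathbb R^{b_k}}^2+\tfrac{\alpha}{2}\|z\|_Z^2+\tfrac{\alpha_{\rm top}}{2}|a|^2$$ over $\sigma\in V^{k-1}$, $u\in V^k$, $p,h\in\mathfrak H^k$, $z\in Z_{\rm ad}$, $a\in A_{\rm ad}$ subject to $$\langle\sigma,\tau\rangle-\langle u,d\tau\rangle=0\quad\forall\tau\in V^{k-1},$$ $$\langle d\sigma,v\rangle+\langle du,dv\rangle+\langle p,v\rangle=\langle f+Bz,v\rangle\quad\forall v\in V^k,$$ $$\langle u,q\rangle=0\quad\forall q\in\mathfrak H^k,\qquad \boldsymbol\Pi h=Ga+c_0 .$$ *)

theory Defs
  imports "HOL-Analysis.Analysis"
begin

definition linear_op_on :: "'a::real_vector set \<Rightarrow> ('a \<Rightarrow> 'b::real_vector) \<Rightarrow> bool" where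
  "linear_op_on S T \<longleftrightarrow>
     (\<forall>x\<in>S. \<forall>y\<in>S. T (x + y) = T x + T y) \<and> (\<forall>c. \<forall>x\<in>S. T (c *\<^sub>R x) = c *\<^sub>R T x)"

definition bounded_linear_op_on ::
  "'a::real_normed_vector set \<Rightarrow> ('a \<Rightarrow> 'b::real_normed_vector) \<Rightarrow> bool" where
  "bounded_linear_op_on S T \<longleftrightarrow>
     linear_op_on S T \<and> (\<exists>K. \<forall>x\<in>S. norm (T x) \<le> K * norm x)"

text \<open>The spaces of a complex are closed subspaces \<open>W k\<close> of one Hilbert space, for every
  integer \<open>k\<close>. This is no restriction: an arbitrary family of Hilbert spaces sits isometrically
  in its \<open>l\<^sup>2\<close> direct sum, and a complex indexed by fewer degrees is continued by
  zero spaces. \<open>V k\<close> is the domain of \<open>d k\<close>; values of \<open>d k\<close> outside \<open>V k\<close> are irrelevant.\<close>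

definition hilbert_complex ::
  "(int \<Rightarrow> 'w::{real_inner,complete_space} set) \<Rightarrow> (int \<Rightarrow> 'w set) \<Rightarrow> (int \<Rightarrow> 'w \<Rightarrow> 'w) \<Rightarrow> bool" where
  "hilbert_complex W V d \<longleftrightarrow>
     (\<forall>k. subspace (W k) \<and> closed (W k) \<and>
          subspace (V k) \<and> V k \<subseteq> W k \<and> W k \<subseteq> closure (V k) \<and>
          linear_op_on (V k) (d k) \<and> d k ` V k \<subseteq> W (k + 1) \<and>
          closed {(x, d k x) | x. x \<in> V k} \<and>
          d k ` V k \<subseteq> V (k + 1) \<and>
          (\<forall>x\<in>V k. d (k + 1) (d k x) = 0))"

definition closed_hilbert_complex ::
  "(int \<Rightarrow> 'w::{real_inner,complete_space} set) \<Rightarrow> (int \<Rightarrow> 'w set) \<Rightarrow> (int \<Rightarrow> 'w \<Rightarrow> 'w) \<Rightarrow> bool" where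
  "closed_hilbert_complex W V d \<longleftrightarrow>
     hilbert_complex W V d \<and> (\<forall>k. closed (d (k - 1) ` V (k - 1)))"

definition harmonic ::
  "(int \<Rightarrow> 'w::real_inner set) \<Rightarrow> (int \<Rightarrow> 'w \<Rightarrow> 'w) \<Rightarrow> int \<Rightarrow> 'w set" where
  "harmonic V d k = {v \<in> V k. d k v = 0} \<inter> orthogonal_comp (d (k - 1) ` V (k - 1))"

definition betti ::
  "(int \<Rightarrow> 'w::real_inner set) \<Rightarrow> (int \<Rightarrow> 'w \<Rightarrow> 'w) \<Rightarrow> int \<Rightarrow> nat" where
  "betti V d k = dim (harmonic V d k)"

text \<open>\<open>\<real>\<^sup>n\<close> is the carrier of the library's \<open>Euclidean_space n\<close>: functions
  \<open>nat \<Rightarrow> real\<close> that vanish from index \<open>n\<close> on. Unlike \<open>real ^ 'n\<close> it allows \<open>n = 0\<close>, which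
  occurs when there are no nonzero harmonic forms.\<close>

abbreviation Rn :: "nat \<Rightarrow> (nat \<Rightarrow> real) set" where
  "Rn n \<equiv> topspace (Euclidean_space n)"

abbreviation Rn_norm :: "nat \<Rightarrow> (nat \<Rightarrow> real) \<Rightarrow> real" where
  "Rn_norm n x \<equiv> L2_set x {..<n}"

definition Rn_convex :: "(nat \<Rightarrow> real) set \<Rightarrow> bool" where
  "Rn_convex A \<longleftrightarrow>
     (\<forall>x\<in>A. \<forall>y\<in>A. \<forall>s\<ge>0. \<forall>t\<ge>0. s + t = 1 \<longrightarrow> (\<lambda>i. s * x i + t * y i) \<in> A)"

definition Rn_isomorphism :: "'a::real_vector set \<Rightarrow> nat \<Rightarrow> ('a \<Rightarrow> nat \<Rightarrow> real) \<Rightarrow> bool" where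
  "Rn_isomorphism H n T \<longleftrightarrow>
     (\<forall>x\<in>H. \<forall>y\<in>H. T (x + y) = (\<lambda>i. T x i + T y i)) \<and>
     (\<forall>c. \<forall>x\<in>H. T (c *\<^sub>R x) = (\<lambda>i. c * T x i)) \<and>
     bij_betw T H (Rn n)"

text \<open>A matrix with \<open>b\<close> rows and \<open>m\<close> columns is \<open>G :: nat \<Rightarrow> nat \<Rightarrow> real\<close>; only the entries
  \<open>G i j\<close> with \<open>i < b\<close> and \<open>j < m\<close> are used.\<close>

definition state_system ::
  "(int \<Rightarrow> 'w::real_inner set) \<Rightarrow> (int \<Rightarrow> 'w \<Rightarrow> 'w) \<Rightarrow> int \<Rightarrow> nat \<Rightarrow> ('z \<Rightarrow> 'w) \<Rightarrow>
   ('w \<Rightarrow> nat \<Rightarrow> real) \<Rightarrow> (nat \<Rightarrow> nat \<Rightarrow> real) \<Rightarrow> 'w \<Rightarrow> (nat \<Rightarrow> real) \<Rightarrow>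
   'w \<Rightarrow> 'w \<Rightarrow> 'w \<Rightarrow> 'w \<Rightarrow> 'z \<Rightarrow> (nat \<Rightarrow> real) \<Rightarrow> bool" where
  "state_system V d k m B \<Pi>H G f c0 \<sigma> u p h z a \<longleftrightarrow>
     \<sigma> \<in> V (k - 1) \<and> u \<in> V k \<and> p \<in> harmonic V d k \<and> h \<in> harmonic V d k \<and>
     (\<forall>\<tau>\<in>V (k - 1). \<sigma> \<bullet> \<tau> - u \<bullet> d (k - 1) \<tau> = 0) \<and>
     (\<forall>v\<in>V k. d (k - 1) \<sigma> \<bullet> v + d k u \<bullet> d k v + p \<bullet> v = (f + B z) \<bullet> v) \<and>
     (\<forall>q\<in>harmonic V d k. u \<bullet> q = 0) \<and>
     (\<forall>i<betti V d k. \<Pi>H h i = (\<Sum>j<m. G i j * a j) + c0 i)"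

definition cost ::
  "(int \<Rightarrow> 'w::real_inner set) \<Rightarrow> (int \<Rightarrow> 'w \<Rightarrow> 'w) \<Rightarrow> int \<Rightarrow> nat \<Rightarrow>
   ('w \<Rightarrow> 'y::real_normed_vector) \<Rightarrow> ('w \<Rightarrow> 's::real_normed_vector) \<Rightarrow> ('w \<Rightarrow> nat \<Rightarrow> real) \<Rightarrow>
   'y \<Rightarrow> 's \<Rightarrow> (nat \<Rightarrow> real) \<Rightarrow> real \<Rightarrow> real \<Rightarrow> real \<Rightarrow> real \<Rightarrow> real \<Rightarrow>
   'w \<Rightarrow> 'w \<Rightarrow> 'w \<Rightarrow> 'z::real_normed_vector \<Rightarrow> (nat \<Rightarrow> real) \<Rightarrow> real" where
  "cost V d k m Ob R \<Pi>H yd rd \<pi>d wy w\<sigma> w\<Pi> \<alpha> \<alpha>top \<sigma> u h z a =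
     wy / 2 * (norm (Ob (u + h) - yd))\<^sup>2 +
     w\<sigma> / 2 * (norm (R \<sigma> - rd))\<^sup>2 +
     w\<Pi> / 2 * (Rn_norm (betti V d k) (\<lambda>i. \<Pi>H h i - \<pi>d i))\<^sup>2 +
     \<alpha> / 2 * (norm z)\<^sup>2 +
     \<alpha>top / 2 * (Rn_norm m a)\<^sup>2"

definition optimal ::
  "('x1 \<Rightarrow> 'x2 \<Rightarrow> 'x3 \<Rightarrow> 'x4 \<Rightarrow> 'z \<Rightarrow> 'a \<Rightarrow> bool) \<Rightarrow> ('x1 \<Rightarrow> 'x2 \<Rightarrow> 'x4 \<Rightarrow> 'z \<Rightarrow> 'a \<Rightarrow> real) \<Rightarrow>
   'z set \<Rightarrow> 'a set \<Rightarrow> 'x1 \<Rightarrow> 'x2 \<Rightarrow> 'x3 \<Rightarrow> 'x4 \<Rightarrow> 'z \<Rightarrow> 'a \<Rightarrow> bool" where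
  "optimal S J Zad Aad \<sigma> u p h z a \<longleftrightarrow>
     z \<in> Zad \<and> a \<in> Aad \<and> S \<sigma> u p h z a \<and>
     (\<forall>\<sigma>' u' p' h' z' a'. z' \<in> Zad \<and> a' \<in> Aad \<and> S \<sigma>' u' p' h' z' a' \<longrightarrow>
        J \<sigma> u h z a \<le> J \<sigma>' u' h' z' a')"

end

theory Submission
  imports Defs
begin

text \<open>The mixed Hodge Laplacian is well posed: closed range of \<open>d\<close> gives a Poincare
  inequality (open mapping theorem), hence a priori bounds for \<open>\<sigma>\<close> and \<open>u\<close>, and a solution is
  assembled from the Hodge decomposition of \<open>f + B z\<close>. The state is therefore a continuous affine
  function of the control \<open>(z, a)\<close>, and substituting it into the cost gives a continuous strongly
  convex function of the control, for which every minimizing sequence is Cauchy.\<close>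

text \<open>The differentials are unbounded, so no limit can be passed through \<open>d\<close> by
  continuity; closed graphs, and Baire's theorem inside the closed range, take over. The two
  harmonic variables are independent: \<open>p\<close> is the harmonic part of the data
  \<open>f + B z\<close>, while \<open>h\<close> is fixed by \<open>a\<close> alone through its
  coordinates. The state thus splits into a Hodge problem driven by \<open>z\<close> and a
  coordinate equation driven by \<open>a\<close>. Strong convexity holds in \<open>(z, a)\<close>
  only, because the tracking terms may be degenerate; uniqueness of the states therefore comes from
  well-posedness and not from the cost. Since minimizing sequences converge in norm, neither weak
  compactness nor weak lower semicontinuity enters. \<open>Rn_norm m\<close> separates only vectors
  that vanish from index \<open>m\<close> on, so the minimization principle is stated with a bare
  gap function \<open>D\<close> in place of a metric. The same principle, with a quarter of the
  squared distance as gap, also yields Riesz representation.\<close>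

section \<open>Minimization and Riesz representation\<close>

text \<open>The point \<open>w\<close> cannot go below the infimum, so \<open>D x y\<close> is at
  most the mean excess of \<open>F x\<close> and \<open>F y\<close> over it. Hence a minimizing
  sequence is Cauchy for \<open>D\<close>, and two minimizers satisfy \<open>D x y \<le> 0\<close>.
  The assumption \<open>lim\<close> merges completeness of \<open>C\<close> with continuity of
  \<open>F\<close>.\<close>

lemma ex1_minimizer_of_strong_midpoint_convexity:
  fixes F :: "'a \<Rightarrow> real" and D :: "'a \<Rightarrow> 'a \<Rightarrow> real"
  assumes "C \<noteq> {}"
    and bdd: "\<And>x. x \<in> C \<Longrightarrow> L \<le> F x"
    and mid: "\<And>x y. x \<in> C \<Longrightarrow> y \<in> C \<Longrightarrow> \<exists>w\<in>C. F w \<le> (F x + F y) / 2 - D x y"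
    and sep: "\<And>x y. x \<in> C \<Longrightarrow> y \<in> C \<Longrightarrow> D x y \<le> 0 \<Longrightarrow> x = y"
    and lim: "\<And>X. (\<And>n. X n \<in> C) \<Longrightarrow> (\<And>e. e > 0 \<Longrightarrow> \<exists>N. \<forall>i\<ge>N. \<forall>j\<ge>N. D (X i) (X j) < e)
               \<Longrightarrow> \<exists>x\<in>C. (\<lambda>n. F (X n)) \<longlonglongrightarrow> F x"
  shows "\<exists>!x. x \<in> C \<and> (\<forall>y\<in>C. F x \<le> F y)"
proof -
  define I where "I = Inf (F ` C)"
  have bb: "bdd_below (F ` C)"
    using bdd by (intro bdd_belowI[of _ L]) blast
  have I_le: "I \<le> F x" if "x \<in> C" for x
    unfolding I_def using that bb by (simp add: cInf_lower)
  have "\<exists>x\<in>C. F x < I + 1 / real (Suc n)" for n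
    using cInf_lessD[of "F ` C" "I + 1 / real (Suc n)"] \<open>C \<noteq> {}\<close> by (auto simp: I_def)
  then obtain X where XC: "\<And>n. X n \<in> C" and XF: "\<And>n. F (X n) < I + 1 / real (Suc n)"
    by metis
  have "\<exists>N. \<forall>i\<ge>N. \<forall>j\<ge>N. D (X i) (X j) < e" if "e > 0" for e
  proof -
    obtain N where N: "1 / real (Suc N) < e"
      using \<open>e > 0\<close> nat_approx_posE by blast
    have "D (X i) (X j) < e" if "i \<ge> N" "j \<ge> N" for i j
    proof -
      have "1 / real (Suc i) \<le> 1 / real (Suc N)" "1 / real (Suc j) \<le> 1 / real (Suc N)"
        using that by (simp_all add: frac_le)
      moreover obtain w where "w \<in> C" "F w \<le> (F (X i) + F (X j)) / 2 - D (X i) (X j)"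
        using mid XC by blast
      ultimately show ?thesis
        using I_le[of w] XF[of i] XF[of j] N by argo
    qed
    then show ?thesis by blast
  qed
  then obtain x where x: "x \<in> C" and lx: "(\<lambda>n. F (X n)) \<longlonglongrightarrow> F x"
    using lim[of X] XC by blast
  have "F x \<le> I + 0"
  proof (rule LIMSEQ_le[OF lx])
    show "(\<lambda>n. I + 1 / real (Suc n)) \<longlonglongrightarrow> I + 0"
      by (intro tendsto_add tendsto_const LIMSEQ_Suc[OF lim_1_over_n])
    show "\<exists>N. \<forall>n\<ge>N. F (X n) \<le> I + 1 / real (Suc n)"
      using XF by (auto intro: less_imp_le)
  qed
  then have min: "\<forall>y\<in>C. F x \<le> F y"
    using I_le by force
  show ?thesis
  proof (rule ex1I[of _ x])
    show "x \<in> C \<and> (\<forall>y\<in>C. F x \<le> F y)"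
      using x min by blast
    fix y assume y: "y \<in> C \<and> (\<forall>z\<in>C. F y \<le> F z)"
    obtain w where w: "w \<in> C" "F w \<le> (F y + F x) / 2 - D y x"
      using mid[of y x] x y by blast
    have "F y \<le> F w" "F x \<le> F w"
      using min y w by auto
    with w have "D y x \<le> 0" by argo
    then show "y = x" using sep x y by blast
  qed
qed

text \<open>The subtracted quarter is the convexity gap of the squared norm; it is the source of the
  constants 1/4 and 1/8 in the gap functions below.\<close>

lemma parallelogram_midpoint:
  fixes x y :: "'a::real_inner"
  shows "(norm ((1/2) *\<^sub>R (x + y)))\<^sup>2 = ((norm x)\<^sup>2 + (norm y)\<^sup>2) / 2 - (norm (x - y))\<^sup>2 / 4"
  unfolding power2_norm_eq_inner
  by (simp add: inner_add_left inner_add_right inner_diff_left inner_diff_right inner_commute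
      field_simps)

lemma Cauchy_of_norm_squared:
  fixes X :: "nat \<Rightarrow> 'a::real_normed_vector"
  assumes "\<And>e. e > 0 \<Longrightarrow> \<exists>N. \<forall>i\<ge>N. \<forall>j\<ge>N. c * (norm (X i - X j))\<^sup>2 < e" and "c > 0"
  shows "Cauchy X"
proof (rule CauchyI)
  fix e :: real assume "e > 0"
  then obtain N where "\<forall>i\<ge>N. \<forall>j\<ge>N. c * (norm (X i - X j))\<^sup>2 < c * e\<^sup>2"
    using assms(1)[of "c * e\<^sup>2"] \<open>c > 0\<close> by auto
  then show "\<exists>M. \<forall>m\<ge>M. \<forall>n\<ge>M. norm (X m - X n) < e"
    using \<open>c > 0\<close> \<open>e > 0\<close> by (auto intro!: exI[of _ N] power2_less_imp_less[where y = e])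
qed

lemma quadratic_nonneg_imp_linear_zero:
  fixes a b :: real
  assumes "\<And>t. 0 \<le> t * b + t\<^sup>2 * a"
  shows "b = 0"
proof (rule ccontr)
  assume "b \<noteq> 0"
  \<comment> \<open>Any positive \<open>s\<close> above \<open>a\<close> would do: at
    \<open>t = - b / s\<close> the polynomial equals \<open>b\<^sup>2 * (a - s) / s\<^sup>2\<close>,
    which is negative.\<close>
  define s where "s = \<bar>a\<bar> + 1"
  have s: "s > 0" "a < s" by (auto simp: s_def)
  have "(- b / s) * b + (- b / s)\<^sup>2 * a = b\<^sup>2 * (a - s) / s\<^sup>2"
    using s by (simp add: field_simps power2_eq_square)
  also have "\<dots> < 0"
    using s \<open>b \<noteq> 0\<close> by (intro divide_neg_pos mult_pos_neg) auto
  finally show False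
    using assms[of "- b / s"] by linarith
qed

text \<open>Closes the energy estimates: after an equation is tested with its own solution, one
  factor \<open>norm x\<close> is cancelled.\<close>

lemma norm_le_of_inner_self:
  fixes x :: "'a::real_inner"
  assumes "x \<bullet> x \<le> c * norm x" "c \<ge> 0"
  shows "norm x \<le> c"
proof (cases "x = 0")
  case False
  have "norm x * norm x \<le> c * norm x"
    using assms(1) by (simp add: dot_square_norm power2_eq_square)
  then show ?thesis using False by simp
qed (use assms in simp)

text \<open>The representative minimizes \<open>\<parallel>x\<parallel>\<^sup>2 - 2 \<phi> x\<close> over the subspace.\<close>

lemma riesz_representation_subspace:
  fixes R :: "'a::{real_inner,complete_space} set"
  assumes R: "subspace R" "closed R"
    and phi: "linear_op_on R \<phi>" and bound: "\<And>x. x \<in> R \<Longrightarrow> \<bar>\<phi> x\<bar> \<le> K * norm x"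
  shows "\<exists>r\<in>R. \<forall>x\<in>R. r \<bullet> x = \<phi> x"
proof -
  have add: "\<phi> (x + y) = \<phi> x + \<phi> y" and scale: "\<phi> (c *\<^sub>R x) = c * \<phi> x"
    if "x \<in> R" "y \<in> R" for x y c
    using phi that by (auto simp: linear_op_on_def)
  have minus: "\<phi> (x - y) = \<phi> x - \<phi> y" if "x \<in> R" "y \<in> R" for x y
    using add[of x "- 1 *\<^sub>R y"] scale[of y y "-1"] that R(1) by (simp add: subspace_neg)
  define F where "F x = (norm x)\<^sup>2 - 2 * \<phi> x" for x
  have "\<exists>!x. x \<in> R \<and> (\<forall>y\<in>R. F x \<le> F y)"
  \<comment> \<open>The linear part of \<open>F\<close> has no convexity gap, so \<open>D\<close> is
    the gap of the squared norm. The lower bound \<open>L\<close> comes from completing the square: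
    \<open>F x\<close> is at least \<open>(norm x - K)\<^sup>2 - K\<^sup>2\<close>.\<close>
  proof (rule ex1_minimizer_of_strong_midpoint_convexity
      [where L = "- K\<^sup>2" and D = "\<lambda>x y. 1/4 * (norm (x - y))\<^sup>2"])
    show "R \<noteq> {}" using R(1) subspace_0 by blast
    show "- K\<^sup>2 \<le> F x" if "x \<in> R" for x
    proof -
      have "0 \<le> (norm x - K)\<^sup>2" by simp
      then show ?thesis
        using bound[OF that] by (simp add: F_def power2_eq_square algebra_simps)
    qed
    show "\<exists>w\<in>R. F w \<le> (F x + F y) / 2 - 1/4 * (norm (x - y))\<^sup>2" if "x \<in> R" "y \<in> R" for x y
    proof (rule bexI[of _ "(1/2) *\<^sub>R (x + y)"])
      show "F ((1/2) *\<^sub>R (x + y)) \<le> (F x + F y) / 2 - 1/4 * (norm (x - y))\<^sup>2"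
        using that R(1) unfolding F_def parallelogram_midpoint
        by (simp add: scale add subspace_add del: scaleR_add_right) (simp add: field_simps)
      show "(1/2) *\<^sub>R (x + y) \<in> R"
        using that R(1) by (intro subspace_scale subspace_add)
    qed
    show "x = y" if "1/4 * (norm (x - y))\<^sup>2 \<le> 0" for x y :: 'a
      using that by simp
    fix X :: "nat \<Rightarrow> 'a"
    assume XR: "\<And>n. X n \<in> R"
      and XD: "\<And>e. 0 < e \<Longrightarrow> \<exists>N. \<forall>i\<ge>N. \<forall>j\<ge>N. 1/4 * (norm (X i - X j))\<^sup>2 < e"
    have "Cauchy X"
      by (rule Cauchy_of_norm_squared[OF XD]) auto
    then obtain x where x: "X \<longlonglongrightarrow> x"
      using Cauchy_convergent_iff convergent_def by blast
    have xR: "x \<in> R"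
      using closed_sequentially[OF R(2)] XR x by blast
    have "(\<lambda>n. \<phi> (X n) - \<phi> x) \<longlonglongrightarrow> 0"
    proof (rule Lim_null_comparison)
      show "\<forall>\<^sub>F n in sequentially. norm (\<phi> (X n) - \<phi> x) \<le> K * norm (X n - x)"
        using bound[of "X n - x" for n] XR xR R(1) by (simp add: minus subspace_diff)
      show "(\<lambda>n. K * norm (X n - x)) \<longlonglongrightarrow> 0"
        using x by (intro tendsto_mult_right_zero tendsto_norm_zero) (simp add: LIM_zero)
    qed
    then have "(\<lambda>n. \<phi> (X n)) \<longlonglongrightarrow> \<phi> x"
      by (simp add: LIM_zero_iff)
    then have "(\<lambda>n. F (X n)) \<longlonglongrightarrow> F x"
      unfolding F_def by (intro tendsto_intros x)
    with xR show "\<exists>x\<in>R. (\<lambda>n. F (X n)) \<longlonglongrightarrow> F x" by blast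
  qed
  then obtain r where r: "r \<in> R" and min: "\<And>y. y \<in> R \<Longrightarrow> F r \<le> F y" by blast
  have "r \<bullet> x = \<phi> x" if x: "x \<in> R" for x
  proof -
    \<comment> \<open>First variation: the right-hand side is
      \<open>F (r + t *\<^sub>R x) - F r\<close>, whose linear coefficient must vanish at a
      minimizer.\<close>
    have "0 \<le> t * (2 * (r \<bullet> x - \<phi> x)) + t\<^sup>2 * (norm x)\<^sup>2" for t
    proof -
      have tx: "t *\<^sub>R x \<in> R" "r + t *\<^sub>R x \<in> R"
        using r x R(1) by (auto intro: subspace_add subspace_scale)
      show ?thesis
        using min[OF tx(2)] r x tx(1) unfolding F_def power2_norm_eq_inner
        by (simp add: add scale inner_add_left inner_add_right inner_commute power2_eq_square
            algebra_simps)
    qed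
    then have "2 * (r \<bullet> x - \<phi> x) = 0"
      by (rule quadratic_nonneg_imp_linear_zero)
    then show ?thesis by simp
  qed
  with r show ?thesis by blast
qed

lemma orthogonal_projection_exists:
  fixes R :: "'a::{real_inner,complete_space} set"
  assumes "subspace R" "closed R"
  obtains r where "r \<in> R" "\<And>x. x \<in> R \<Longrightarrow> r \<bullet> x = g \<bullet> x"
proof -
  have "\<exists>r\<in>R. \<forall>x\<in>R. r \<bullet> x = g \<bullet> x"
    by (rule riesz_representation_subspace[OF assms, where K = "norm g"])
      (auto simp: linear_op_on_def inner_add_right Cauchy_Schwarz_ineq2)
  then show ?thesis using that by blast
qed

section \<open>Closed operators with closed range\<close>

definition closed_op_on :: "'a::real_normed_vector set \<Rightarrow> ('a \<Rightarrow> 'b::real_normed_vector) \<Rightarrow> bool" where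
  "closed_op_on V T \<longleftrightarrow> subspace V \<and> linear_op_on V T \<and> closed {(x, T x) | x. x \<in> V}"

text \<open>The substitute for continuity of \<open>T\<close>: convergence of the images is assumed,
  and the graph then identifies their limit.\<close>

lemma closed_op_on_seq:
  assumes "closed_op_on V T" "\<And>n::nat. X n \<in> V" "X \<longlonglongrightarrow> x" "(\<lambda>n. T (X n)) \<longlonglongrightarrow> y"
  shows "x \<in> V" "T x = y"
proof -
  have "(x, y) \<in> {(x, T x) | x. x \<in> V}"
  proof (rule closed_sequentially)
    show "closed {(x, T x) | x. x \<in> V}" using assms(1) by (simp add: closed_op_on_def)
    show "(\<lambda>n. (X n, T (X n))) \<longlonglongrightarrow> (x, y)" using assms by (intro tendsto_Pair)
  qed (use assms in auto)
  then show "x \<in> V" "T x = y" by auto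
qed

lemma linear_op_on_diff:
  assumes "subspace V" "linear_op_on V T" "x \<in> V" "y \<in> V"
  shows "T (x - y) = T x - T y"
proof -
  have "(- 1) *\<^sub>R y \<in> V" using assms by (simp only: subspace_scale)
  then have "T (x + (- 1) *\<^sub>R y) = T x + (- 1) *\<^sub>R T y"
    using assms unfolding linear_op_on_def by metis
  then show ?thesis by simp
qed

lemma linear_op_on_0:
  assumes "subspace V" "linear_op_on V T"
  shows "T 0 = 0"
  using linear_op_on_diff[OF assms subspace_0 subspace_0] assms(1) by simp

lemma linear_op_on_sum:
  assumes "subspace V" "linear_op_on V T" "\<And>i. i \<in> I \<Longrightarrow> x i \<in> V"
  shows "T (sum x I) = (\<Sum>i\<in>I. T (x i))"
  using assms(3)
proof (induction I rule: infinite_finite_induct)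
  case (insert i I)
  then have "sum x I \<in> V" using assms(1) by (simp add: subspace_sum)
  with insert assms(2) show ?case by (simp add: linear_op_on_def)
qed (simp_all add: linear_op_on_0[OF assms(1,2)])

lemma subspace_linear_op_on_image:
  assumes "subspace V" "linear_op_on V T"
  shows "subspace (T ` V)"
  unfolding subspace_def
proof (intro conjI ballI allI)
  show "0 \<in> T ` V"
    using linear_op_on_0[OF assms] subspace_0[OF assms(1)] by force
  show "a + b \<in> T ` V" if ab: "a \<in> T ` V" "b \<in> T ` V" for a b
  proof -
    obtain x y where xy: "x \<in> V" "a = T x" "y \<in> V" "b = T y" using ab by blast
    then have "a + b = T (x + y)" using assms by (simp add: linear_op_on_def)
    then show ?thesis using xy subspace_add[OF assms(1)] by blast
  qed
  show "c *\<^sub>R a \<in> T ` V" if a: "a \<in> T ` V" for a c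
  proof -
    obtain x where x: "x \<in> V" "a = T x" using a by blast
    then have "c *\<^sub>R a = T (c *\<^sub>R x)" using assms by (simp add: linear_op_on_def)
    then show ?thesis using x subspace_scale[OF assms(1)] by blast
  qed
qed

text \<open>Although \<open>V\<close> itself may fail to be closed, the images along a sequence in
  the kernel are constantly 0, so the closed graph keeps the limit in \<open>V\<close>.\<close>

lemma kernel_closed_op_on:
  assumes "closed_op_on V T"
  shows "subspace {v \<in> V. T v = 0}" "closed {v \<in> V. T v = 0}"
proof -
  have V: "subspace V" "linear_op_on V T" using assms by (auto simp: closed_op_on_def)
  show "subspace {v \<in> V. T v = 0}"
    using V linear_op_on_0[OF V] by (auto simp: subspace_def linear_op_on_def)
  show "closed {v \<in> V. T v = 0}"
    unfolding closed_sequential_limits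
  proof (intro allI impI, elim conjE)
    fix X x assume X: "\<forall>n. X n \<in> {v \<in> V. T v = 0}" and "X \<longlonglongrightarrow> x"
    then show "x \<in> {v \<in> V. T v = 0}"
      using closed_op_on_seq[OF assms, of X x 0] by simp
  qed
qed

text \<open>Subtracting from any preimage its projection onto the kernel leaves the preimage of
  least norm, the value of the pseudoinverse.\<close>

lemma preimage_orthogonal_to_kernel:
  fixes T :: "'a::{real_inner,complete_space} \<Rightarrow> 'b::real_normed_vector"
  assumes T: "closed_op_on V T" and "y \<in> T ` V"
  obtains w where "w \<in> V" "T w = y" "\<And>v. v \<in> V \<Longrightarrow> T v = 0 \<Longrightarrow> w \<bullet> v = 0"
proof -
  have V: "subspace V" "linear_op_on V T" using T by (auto simp: closed_op_on_def)
  obtain w0 where w0: "w0 \<in> V" "T w0 = y" using assms by blast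
  obtain r where r: "r \<in> {v \<in> V. T v = 0}" "\<And>v. v \<in> {v \<in> V. T v = 0} \<Longrightarrow> r \<bullet> v = w0 \<bullet> v"
    using orthogonal_projection_exists[OF kernel_closed_op_on[OF T], where g = w0] by blast
  show ?thesis
    using r w0 V
    by (intro that[of "w0 - r"]) (auto simp: subspace_diff linear_op_on_diff inner_diff_left)
qed

text \<open>Half of the open mapping theorem: Baire's theorem gives approximate preimages.\<close>

lemma approximate_preimage_bound:
  fixes T :: "'a::real_normed_vector \<Rightarrow> 'b::{real_normed_vector,complete_space}"
  assumes V: "subspace V" "linear_op_on V T" and R: "closed (T ` V)"
  obtains c where "c > 0"
    "\<And>y e. y \<in> T ` V \<Longrightarrow> e > 0 \<Longrightarrow> \<exists>x\<in>V. norm x \<le> c * norm y \<and> norm (y - T x) < e"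
proof -
  define R where "R = T ` V"
  define A where "A n = closure (T ` {x \<in> V. norm x \<le> real n})" for n
  have sR: "subspace R" unfolding R_def by (rule subspace_linear_op_on_image[OF V])
  have cR: "closed R" using R by (simp add: R_def)
  have AR: "A n \<subseteq> R" for n
    unfolding A_def using cR by (intro closure_minimal) (auto simp: R_def)
  have cover: "\<Union>(range A) = R"
  proof
    show "R \<subseteq> \<Union>(range A)"
    proof
      fix y assume "y \<in> R"
      then obtain x where x: "x \<in> V" "y = T x" by (auto simp: R_def)
      obtain n where "norm x \<le> real n" using real_arch_simple by blast
      then have "y \<in> A n" unfolding A_def using x by (intro subsetD[OF closure_subset]) auto
      then show "y \<in> \<Union>(range A)" by blast
    qed
  qed (use AR in blast)
  \<comment> \<open>Baire is applied in \<open>R\<close>, which is complete as a closed set. The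
    interior is relative to \<open>R\<close>, since \<open>R\<close> may have empty interior in the
    whole space.\<close>
  have "\<exists>n. top_of_set R interior_of A n \<noteq> {}"
  proof (rule ccontr)
    assume "\<not> ?thesis"
    moreover have "completely_metrizable_space (top_of_set R)"
      by (rule completely_metrizable_space_closedin[OF completely_metrizable_space_euclidean])
        (simp add: cR)
    moreover have "closedin (top_of_set R) (A n)" for n
      using AR[of n] by (intro closed_subset) (simp_all add: A_def)
    ultimately have "top_of_set R interior_of \<Union>(range A) = {}"
      by (intro Baire_category_alt) auto
    then have "R = {}"
      using interior_of_topspace[of "top_of_set R"] by (simp only: cover topspace_euclidean_subtopology)
    then show False using sR subspace_0 by blast
  qed
  then obtain n y0 where y0: "y0 \<in> top_of_set R interior_of A n" by blast
  have "openin (top_of_set R) (top_of_set R interior_of A n)"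
    by (rule openin_interior_of)
  then obtain r where r: "r > 0" "ball y0 r \<inter> R \<subseteq> top_of_set R interior_of A n" and y0R: "y0 \<in> R"
    using y0 unfolding openin_contains_ball by blast
  have rA: "ball y0 r \<inter> R \<subseteq> A n"
    using r(2) interior_of_subset[of "top_of_set R" "A n"] by (rule order_trans)
  \<comment> \<open>Both \<open>y0 + y\<close> and \<open>y0\<close> are limits of images of vectors
    of norm at most \<open>n\<close>. Their difference moves the centre of the ball to 0, at the
    price of the factor 2.\<close>
  have approx: "\<exists>x\<in>V. norm x \<le> 2 * real n \<and> norm (y - T x) < e"
    if y: "y \<in> R" "norm y < r" and "e > 0" for y e
  proof -
    have "y0 + y \<in> A n" "y0 \<in> A n"
      using r y y0R sR by (auto intro!: subsetD[OF rA] simp: dist_norm subspace_add)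
    then obtain x1 x2 where x: "x1 \<in> V" "norm x1 \<le> n" "dist (T x1) (y0 + y) < e / 2"
      "x2 \<in> V" "norm x2 \<le> n" "dist (T x2) y0 < e / 2"
      unfolding A_def closure_approachable using \<open>e > 0\<close> half_gt_zero by blast
    have "norm (x1 - x2) \<le> 2 * real n"
      using norm_triangle_ineq4[of x1 x2] x by linarith
    moreover have "norm (y - T (x1 - x2)) < e"
    proof -
      have eq: "y - T (x1 - x2) = (T x2 - y0) - (T x1 - (y0 + y))"
        by (simp add: linear_op_on_diff[OF V] x)
      show ?thesis
        unfolding eq using norm_triangle_ineq4[of "T x2 - y0" "T x1 - (y0 + y)"] x(3,6)
        unfolding dist_norm by linarith
    qed
    ultimately show ?thesis using x V by (meson subspace_diff)
  qed
  \<comment> \<open>Scaling \<open>y\<close> to norm \<open>r / 2\<close> and back multiplies the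
    bound \<open>2 * n\<close> by \<open>2 * norm y / r\<close>, which gives
    \<open>4 * n / r\<close>; the added 1 keeps \<open>c\<close> positive when
    \<open>n = 0\<close>.\<close>
  define c where "c = (4 * real n + 1) / r"
  show ?thesis
  proof (rule that[of c])
    show "c > 0" using r by (simp add: c_def)
    fix y e assume y: "y \<in> T ` V" and e: "e > (0::real)"
    show "\<exists>x\<in>V. norm x \<le> c * norm y \<and> norm (y - T x) < e"
    proof (cases "y = 0")
      case True
      then show ?thesis
        using V e by (intro bexI[of _ 0]) (auto simp: linear_op_on_0 subspace_0)
    next
      case False
      define s where "s = r / (2 * norm y)"
      have s: "s > 0" using False r by (simp add: s_def)
      have "s *\<^sub>R y \<in> R" "norm (s *\<^sub>R y) < r"
        using y sR False r by (auto simp: R_def[symmetric] subspace_scale s_def)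
      then obtain x where x: "x \<in> V" "norm x \<le> 2 * real n" "norm (s *\<^sub>R y - T x) < s * e"
        using approx[of "s *\<^sub>R y" "s * e"] s e by auto
      have Tx: "T ((1 / s) *\<^sub>R x) = (1 / s) *\<^sub>R T x"
        using V x by (simp add: linear_op_on_def)
      have "norm (y - T ((1 / s) *\<^sub>R x)) = norm ((1 / s) *\<^sub>R (s *\<^sub>R y - T x))"
        using s unfolding Tx by (simp add: scaleR_diff_right)
      also have "\<dots> = norm (s *\<^sub>R y - T x) / s"
        using s by (simp only: norm_scaleR) simp
      also have "\<dots> < e" using s x(3) by (simp add: field_simps del: norm_scaleR scaleR_diff_right)
      finally have "norm (y - T ((1 / s) *\<^sub>R x)) < e" .
      moreover have "norm ((1 / s) *\<^sub>R x) \<le> c * norm y"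
      proof -
        have "norm ((1 / s) *\<^sub>R x) = norm x * (2 * norm y / r)"
          using s r by (simp add: s_def)
        also have "\<dots> \<le> (2 * real n) * (2 * norm y / r)"
          using x r by (intro mult_right_mono) auto
        also have "\<dots> \<le> c * norm y"
          using r by (simp add: c_def field_simps)
        finally show ?thesis .
      qed
      ultimately show ?thesis using x V by (meson subspace_scale)
    qed
  qed
qed

lemma dominated_partial_sums_converge:
  fixes x :: "nat \<Rightarrow> 'a::{real_normed_vector,complete_space}"
  assumes le: "\<And>n. norm (x n) \<le> g n" and g: "g sums L"
  obtains l where "(\<lambda>n. \<Sum>i<n. x i) \<longlonglongrightarrow> l" "norm l \<le> L"
proof -
  have "Cauchy (\<lambda>n. \<Sum>i<n. g i)"
    using g unfolding sums_def by (rule LIMSEQ_imp_Cauchy)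
  have tail: "norm ((\<Sum>i<m. x i) - (\<Sum>i<n. x i)) \<le> norm ((\<Sum>i<m. g i) - (\<Sum>i<n. g i))"
    if "n \<le> m" for m n
  proof -
    have "(\<Sum>i<m. f i) - (\<Sum>i<n. f i) = sum f {n..<m}" for f :: "nat \<Rightarrow> 'b::real_normed_vector"
      using sum_diff_nat_ivl[of 0 n m f] that by (simp add: atLeast0LessThan)
    moreover have "norm (sum x {n..<m}) \<le> sum g {n..<m}"
      by (rule sum_norm_le) (rule le)
    ultimately show ?thesis by (metis abs_ge_self order_trans real_norm_def)
  qed
  have "Cauchy (\<lambda>n. \<Sum>i<n. x i)"
  proof (rule CauchyI)
    fix e :: real assume "e > 0"
    then obtain M where M: "\<And>m n. m \<ge> M \<Longrightarrow> n \<ge> M \<Longrightarrow> norm ((\<Sum>i<m. g i) - (\<Sum>i<n. g i)) < e"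
      using CauchyD[OF \<open>Cauchy (\<lambda>n. \<Sum>i<n. g i)\<close>] by blast
    have "norm ((\<Sum>i<m. x i) - (\<Sum>i<n. x i)) < e" if "m \<ge> M" "n \<ge> M" for m n
      using tail[of n m] tail[of m n] M[OF that] M[OF that(2,1)]
      by (cases "n \<le> m") (auto simp: norm_minus_commute)
    then show "\<exists>M. \<forall>m\<ge>M. \<forall>n\<ge>M. norm ((\<Sum>i<m. x i) - (\<Sum>i<n. x i)) < e" by blast
  qed
  then obtain l where l: "(\<lambda>n. \<Sum>i<n. x i) \<longlonglongrightarrow> l"
    using Cauchy_convergent_iff convergent_def by blast
  have "norm l \<le> L"
  proof (rule LIMSEQ_le[OF tendsto_norm[OF l]])
    show "(\<lambda>n. \<Sum>i<n. g i) \<longlonglongrightarrow> L" using g by (simp add: sums_def)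
    show "\<exists>N. \<forall>n\<ge>N. norm (\<Sum>i<n. x i) \<le> (\<Sum>i<n. g i)"
      by (intro exI allI impI sum_norm_le le)
  qed
  with l that show ?thesis by blast
qed

text \<open>The other half of the open mapping theorem, by successive approximation. Each correction
  halves the bound on the residual, so the corrections are dominated by a geometric series whose sum
  is twice its first term; hence the constant \<open>2 * c\<close>. The closed graph identifies the
  image of the limit.\<close>

lemma closed_op_bounded_preimage:
  fixes T :: "'a::{real_normed_vector,complete_space} \<Rightarrow> 'b::{real_normed_vector,complete_space}"
  assumes T: "closed_op_on V T" and R: "closed (T ` V)"
  obtains c where "c > 0" "\<And>y. y \<in> T ` V \<Longrightarrow> \<exists>x\<in>V. T x = y \<and> norm x \<le> c * norm y"
proof -
  have V: "subspace V" "linear_op_on V T" using T by (auto simp: closed_op_on_def)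
  obtain c where c: "c > 0"
    and app: "\<And>y e. y \<in> T ` V \<Longrightarrow> e > 0 \<Longrightarrow> \<exists>x\<in>V. norm x \<le> c * norm y \<and> norm (y - T x) < e"
    using approximate_preimage_bound[OF V R] by blast
  have "\<exists>x\<in>V. T x = y \<and> norm x \<le> 2 * c * norm y" if y: "y \<in> T ` V" for y
  proof (cases "y = 0")
    case True
    then show ?thesis
      using V c by (intro bexI[of _ 0]) (auto simp: linear_op_on_0 subspace_0)
  next
    case False
    \<comment> \<open>The tolerances are proportional to \<open>norm y\<close> so that the final
      bound is too; they must be positive, which is why \<open>y = 0\<close> is treated
      apart.\<close>
    define E where "E n = norm y * (1/2) ^ n" for n
    have E: "E n > 0" for n using False by (simp add: E_def)
    have step: "\<exists>x. x \<in> V \<and> norm x \<le> c * norm z \<and> norm (z - T x) < E n" if "z \<in> T ` V" for z n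
      using app[OF that E] by blast
    define g where "g z n = (SOME x. x \<in> V \<and> norm x \<le> c * norm z \<and> norm (z - T x) < E n)" for z n
    have g: "g z n \<in> V" "norm (g z n) \<le> c * norm z" "norm (z - T (g z n)) < E n"
      if "z \<in> T ` V" for z n
      using someI_ex[OF step[OF that, of n]] by (auto simp: g_def)
    \<comment> \<open>\<open>z n\<close> is the residual after \<open>n\<close> corrections. The
      next one uses tolerance \<open>Suc n\<close>, so that \<open>norm (z n) \<le> E n\<close>
      holds for every \<open>n\<close>, starting with equality at \<open>z 0 = y\<close>.\<close>
    define z where "z = rec_nat y (\<lambda>n w. w - T (g w (Suc n)))"
    have z0: "z 0 = y" and zS: "z (Suc n) = z n - T (g (z n) (Suc n))" for n
      by (simp_all add: z_def)
    have zR: "z n \<in> T ` V" for n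
    proof (induction n)
      case (Suc n)
      then show ?case
        unfolding zS using g subspace_linear_op_on_image[OF V] by (intro subspace_diff) auto
    qed (simp add: z0 y)
    have zE: "norm (z n) \<le> E n" for n
      by (cases n) (use g(3)[OF zR] in \<open>auto simp: z0 zS E_def[of 0] intro: less_imp_le\<close>)
    define x where "x n = g (z n) (Suc n)" for n
    have xV: "x n \<in> V" for n using g(1)[OF zR] by (simp add: x_def)
    have xE: "norm (x n) \<le> c * norm y * (1/2) ^ n" for n
    proof -
      have "norm (x n) \<le> c * norm (z n)" using g(2)[OF zR] by (simp add: x_def)
      also have "\<dots> \<le> c * E n" using zE c by simp
      finally show ?thesis by (simp add: E_def)
    qed
    have gs: "(\<lambda>n. c * norm y * (1/2) ^ n) sums (c * norm y * 2)"
      using geometric_sums[of "1/2::real"] by (intro sums_mult) simp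
    have partial: "(\<Sum>i<n. x i) \<in> V" "T (\<Sum>i<n. x i) = y - z n" for n
    proof -
      show "(\<Sum>i<n. x i) \<in> V" using xV V by (simp add: subspace_sum)
      have "(\<Sum>i<n. T (x i)) = y - z n"
        by (induction n) (simp_all add: z0 zS x_def)
      then show "T (\<Sum>i<n. x i) = y - z n"
        using linear_op_on_sum[OF V, of "{..<n}" x] xV by simp
    qed
    have "z \<longlonglongrightarrow> 0"
    proof (rule Lim_null_comparison)
      show "\<forall>\<^sub>F n in sequentially. norm (z n) \<le> E n" using zE by simp
      show "E \<longlonglongrightarrow> 0" unfolding E_def
        by (intro tendsto_mult_right_zero LIMSEQ_power_zero) simp
    qed
    then have lim: "(\<lambda>n. T (\<Sum>i<n. x i)) \<longlonglongrightarrow> y"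
      unfolding partial using tendsto_diff[OF tendsto_const, of z 0 sequentially y] by simp
    obtain l where l: "(\<lambda>n. \<Sum>i<n. x i) \<longlonglongrightarrow> l" "norm l \<le> c * norm y * 2"
      using dominated_partial_sums_converge[OF xE gs] by blast
    have "l \<in> V" "T l = y"
      by (rule closed_op_on_seq[OF T partial(1) l(1) lim])+
    moreover have "norm l \<le> 2 * c * norm y"
      using l(2) by (simp add: mult_ac)
    ultimately show ?thesis by blast
  qed
  then show ?thesis using that[of "2 * c"] c by auto
qed

text \<open>If \<open>x\<close> is orthogonal to the kernel and \<open>x'\<close> is another
  preimage of \<open>T x\<close>, then \<open>x \<bullet> (x - x') = 0\<close>. By Cauchy-Schwarz
  \<open>x\<close> is no longer than \<open>x'\<close>, so it inherits the bound of a controlled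
  preimage.\<close>

lemma poincare_inequality:
  fixes T :: "'a::{real_inner,complete_space} \<Rightarrow> 'b::{real_normed_vector,complete_space}"
  assumes T: "closed_op_on V T" and R: "closed (T ` V)"
  obtains c where "c > 0" "\<And>y. y \<in> T ` V \<Longrightarrow> \<exists>x\<in>V. T x = y \<and> norm x \<le> c * norm y"
    "\<And>x. x \<in> V \<Longrightarrow> (\<And>v. v \<in> V \<Longrightarrow> T v = 0 \<Longrightarrow> x \<bullet> v = 0) \<Longrightarrow> norm x \<le> c * norm (T x)"
proof -
  have V: "subspace V" "linear_op_on V T" using T by (auto simp: closed_op_on_def)
  obtain c where c: "c > 0" and pre: "\<And>y. y \<in> T ` V \<Longrightarrow> \<exists>x\<in>V. T x = y \<and> norm x \<le> c * norm y"
    using closed_op_bounded_preimage[OF assms] by blast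
  show ?thesis
  proof (rule that[OF c pre])
    fix x assume x: "x \<in> V" and orth: "\<And>v. v \<in> V \<Longrightarrow> T v = 0 \<Longrightarrow> x \<bullet> v = 0"
    obtain x' where x': "x' \<in> V" "T x' = T x" "norm x' \<le> c * norm (T x)"
      using pre x by blast
    have "x \<bullet> (x - x') = 0"
      using x x' V by (intro orth) (auto simp: subspace_diff linear_op_on_diff)
    then have "norm x * norm x \<le> norm x * norm x'"
      using norm_cauchy_schwarz[of x x'] by (simp add: inner_diff_right dot_square_norm power2_eq_square)
    then have "norm x \<le> norm x'"
      by (cases "x = 0") auto
    with x' show "norm x \<le> c * norm (T x)" by linarith
  qed
qed

text \<open>The range of the adjoint is the orthogonal complement of the kernel.\<close>

lemma functional_factors_through_closed_op:
  fixes T :: "'a::{real_inner,complete_space} \<Rightarrow> 'b::{real_inner,complete_space}"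
  assumes T: "closed_op_on V T" and R: "closed (T ` V)"
    and l: "\<And>v. v \<in> V \<Longrightarrow> T v = 0 \<Longrightarrow> l \<bullet> v = 0"
  obtains e where "e \<in> T ` V" "\<And>v. v \<in> V \<Longrightarrow> e \<bullet> T v = l \<bullet> v"
proof -
  have V: "subspace V" "linear_op_on V T" using T by (auto simp: closed_op_on_def)
  obtain c where c: "c > 0" and pre: "\<And>y. y \<in> T ` V \<Longrightarrow> \<exists>x\<in>V. T x = y \<and> norm x \<le> c * norm y"
    using closed_op_bounded_preimage[OF T R] by blast
  \<comment> \<open>Preimages differ by kernel elements, on which \<open>l\<close> vanishes, so the
    choice is immaterial. A preimage of controlled norm makes this functional bounded on the
    range.\<close>
  define \<phi> where "\<phi> y = l \<bullet> (SOME x. x \<in> V \<and> T x = y)" for y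
  have phi: "\<phi> y = l \<bullet> x" if "x \<in> V" "T x = y" for x y
  proof -
    have "(SOME x. x \<in> V \<and> T x = y) \<in> V \<and> T (SOME x. x \<in> V \<and> T x = y) = y"
      by (rule someI[of _ x]) (use that in auto)
    then have "l \<bullet> ((SOME x. x \<in> V \<and> T x = y) - x) = 0"
      using that V by (intro l) (auto simp: subspace_diff linear_op_on_diff)
    then show ?thesis by (simp add: \<phi>_def inner_diff_right)
  qed
  have "\<exists>e\<in>T ` V. \<forall>y\<in>T ` V. e \<bullet> y = \<phi> y"
  proof (rule riesz_representation_subspace[OF subspace_linear_op_on_image[OF V] R])
    show "linear_op_on (T ` V) \<phi>"
      unfolding linear_op_on_def
    proof (intro conjI ballI allI; clarify)
      fix x y assume "x \<in> V" "y \<in> V"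
      then show "\<phi> (T x + T y) = \<phi> (T x) + \<phi> (T y)"
        using V phi[of "x + y"] phi[of x] phi[of y]
        by (simp add: linear_op_on_def subspace_add inner_add_right)
    next
      fix a x assume "x \<in> V"
      then show "\<phi> (a *\<^sub>R T x) = a *\<^sub>R \<phi> (T x)"
        using V phi[of "a *\<^sub>R x"] phi[of x] by (simp add: linear_op_on_def subspace_scale)
    qed
    show "\<bar>\<phi> y\<bar> \<le> (norm l * c) * norm y" if y: "y \<in> T ` V" for y
    proof -
      obtain x where x: "x \<in> V" "T x = y" "norm x \<le> c * norm y" using pre y by blast
      have "\<bar>\<phi> y\<bar> \<le> norm l * norm x" using phi[OF x(1,2)] by (simp add: Cauchy_Schwarz_ineq2)
      also have "\<dots> \<le> norm l * (c * norm y)" using x by (intro mult_left_mono) auto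
      finally show ?thesis by (simp add: mult.assoc)
    qed
  qed
  then show ?thesis using that phi by (metis image_eqI)
qed

section \<open>The mixed Hodge Laplacian\<close>

text \<open>\<open>T\<close> and \<open>S\<close> model \<open>d (k - 1)\<close> and
  \<open>d k\<close> with domains \<open>U\<close> and \<open>V\<close>. Three type variables keep
  the degrees apart; in the application all of them are the ambient Hilbert space.\<close>

locale closed_complex_segment =
  fixes U :: "'a::{real_inner,complete_space} set"
    and T :: "'a \<Rightarrow> 'b::{real_inner,complete_space}"
    and V :: "'b set"
    and S :: "'b \<Rightarrow> 'c::{real_inner,complete_space}"
  assumes T: "closed_op_on U T" and range_T: "closed (T ` U)"
    and S: "closed_op_on V S" and range_S: "closed (S ` V)"
    and T_V: "\<And>x. x \<in> U \<Longrightarrow> T x \<in> V" and S_T: "\<And>x. x \<in> U \<Longrightarrow> S (T x) = 0"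
begin

definition H :: "'b set" where
  "H = {v \<in> V. S v = 0} \<inter> orthogonal_comp (T ` U)"

definition mixed_solution :: "'b \<Rightarrow> 'a \<Rightarrow> 'b \<Rightarrow> 'b \<Rightarrow> bool" where
  "mixed_solution g \<sigma> u p \<longleftrightarrow> \<sigma> \<in> U \<and> u \<in> V \<and> p \<in> H \<and>
     (\<forall>\<tau>\<in>U. \<sigma> \<bullet> \<tau> = u \<bullet> T \<tau>) \<and>
     (\<forall>v\<in>V. T \<sigma> \<bullet> v + S u \<bullet> S v + p \<bullet> v = g \<bullet> v) \<and>
     (\<forall>q\<in>H. u \<bullet> q = 0)"

lemma linear_T: "subspace U" "linear_op_on U T"
  and linear_S: "subspace V" "linear_op_on V S"
  using T S by (auto simp: closed_op_on_def)

lemma subspace_range_T: "subspace (T ` U)"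
  by (rule subspace_linear_op_on_image[OF linear_T])

lemma H_iff: "v \<in> H \<longleftrightarrow> v \<in> V \<and> S v = 0 \<and> (\<forall>x\<in>U. v \<bullet> T x = 0)"
  by (auto simp: H_def orthogonal_comp_def orthogonal_def inner_commute)

lemma subspace_H: "subspace H"
  unfolding H_def
  by (intro subspace_inter kernel_closed_op_on(1)[OF S] subspace_orthogonal_comp)

lemma closed_H: "closed H"
proof -
  have "orthogonal_comp (T ` U) = (\<Inter>y\<in>T ` U. {x. y \<bullet> x = 0})"
    by (auto simp: orthogonal_comp_def orthogonal_def)
  then have "closed (orthogonal_comp (T ` U))"
    by (simp add: closed_hyperplane closed_INT)
  then show ?thesis
    unfolding H_def by (intro closed_Int kernel_closed_op_on(2)[OF S])
qed

text \<open>Hodge decomposition of the kernel of \<open>S\<close>: projecting onto the closed range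
  of \<open>T\<close> leaves a remainder orthogonal to that range, still in the kernel because
  \<open>S\<close> vanishes on the range of \<open>T\<close>.\<close>

lemma kernel_decomposition:
  assumes "v \<in> V" "S v = 0"
  obtains x h where "x \<in> U" "h \<in> H" "v = T x + h"
proof -
  obtain b where b: "b \<in> T ` U" "\<And>y. y \<in> T ` U \<Longrightarrow> b \<bullet> y = v \<bullet> y"
    using orthogonal_projection_exists[OF subspace_range_T range_T, where g = v] by blast
  then obtain x where x: "x \<in> U" "b = T x" by blast
  have "v - b \<in> H"
    using assms x b T_V S_T linear_S
    by (simp add: H_iff subspace_diff linear_op_on_diff inner_diff_left)
  then show ?thesis using that x by force
qed

text \<open>Used with coefficients 1 and -1 for uniqueness and continuity, and with 1/2 and 1/2 for
  midpoint convexity.\<close>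

lemma mixed_solution_combination:
  assumes "mixed_solution g \<sigma> u p" "mixed_solution g' \<sigma>' u' p'"
  shows "mixed_solution (s *\<^sub>R g + t *\<^sub>R g') (s *\<^sub>R \<sigma> + t *\<^sub>R \<sigma>') (s *\<^sub>R u + t *\<^sub>R u')
    (s *\<^sub>R p + t *\<^sub>R p')"
proof -
  have a: "\<sigma> \<in> U" "u \<in> V" "p \<in> H" "\<sigma>' \<in> U" "u' \<in> V" "p' \<in> H"
    and b: "\<And>\<tau>. \<tau> \<in> U \<Longrightarrow> \<sigma> \<bullet> \<tau> = u \<bullet> T \<tau>" "\<And>\<tau>. \<tau> \<in> U \<Longrightarrow> \<sigma>' \<bullet> \<tau> = u' \<bullet> T \<tau>"
    and c: "\<And>v. v \<in> V \<Longrightarrow> g \<bullet> v = T \<sigma> \<bullet> v + S u \<bullet> S v + p \<bullet> v"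
      "\<And>v. v \<in> V \<Longrightarrow> g' \<bullet> v = T \<sigma>' \<bullet> v + S u' \<bullet> S v + p' \<bullet> v"
    and e: "\<And>q. q \<in> H \<Longrightarrow> u \<bullet> q = 0" "\<And>q. q \<in> H \<Longrightarrow> u' \<bullet> q = 0"
    using assms by (auto simp: mixed_solution_def)
  have TS: "T (s *\<^sub>R \<sigma> + t *\<^sub>R \<sigma>') = s *\<^sub>R T \<sigma> + t *\<^sub>R T \<sigma>'"
    "S (s *\<^sub>R u + t *\<^sub>R u') = s *\<^sub>R S u + t *\<^sub>R S u'"
    using a linear_T linear_S by (simp_all add: linear_op_on_def subspace_scale)
  have "s *\<^sub>R \<sigma> + t *\<^sub>R \<sigma>' \<in> U" "s *\<^sub>R u + t *\<^sub>R u' \<in> V" "s *\<^sub>R p + t *\<^sub>R p' \<in> H"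
    using a linear_T(1) linear_S(1) subspace_H by (simp_all add: subspace_add subspace_scale)
  then show ?thesis
    unfolding mixed_solution_def TS
    by (auto simp: inner_add_left b c e algebra_simps)
qed

text \<open>With adjoints the system reads \<open>\<sigma> = T* u\<close> and
  \<open>T \<sigma> + S* S u + p = g\<close>, with \<open>u\<close> orthogonal to \<open>H\<close>.
  Projections of \<open>g\<close> give \<open>p\<close> and \<open>y = T \<sigma>\<close>; taking
  \<open>\<sigma>\<close> orthogonal to the kernel of \<open>T\<close> makes
  \<open>T* w = \<sigma>\<close> solvable. The rest of \<open>g\<close> is matched by
  \<open>S* S w'\<close>. The two parts of \<open>u\<close> do not interfere, since
  \<open>S w = 0\<close> and \<open>w'\<close> is orthogonal to the range of
  \<open>T\<close>.\<close>

lemma mixed_solution_exists: "\<exists>\<sigma> u p. mixed_solution g \<sigma> u p"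
proof -
  obtain p where p: "p \<in> H" "\<And>q. q \<in> H \<Longrightarrow> p \<bullet> q = g \<bullet> q"
    using orthogonal_projection_exists[OF subspace_H closed_H, where g = g] by blast
  obtain y where y: "y \<in> T ` U" "\<And>x. x \<in> T ` U \<Longrightarrow> y \<bullet> x = g \<bullet> x"
    using orthogonal_projection_exists[OF subspace_range_T range_T, where g = g] by blast
  obtain \<sigma> where \<sigma>: "\<sigma> \<in> U" "T \<sigma> = y" "\<And>\<tau>. \<tau> \<in> U \<Longrightarrow> T \<tau> = 0 \<Longrightarrow> \<sigma> \<bullet> \<tau> = 0"
    using preimage_orthogonal_to_kernel[OF T y(1)] by blast
  obtain w where w: "w \<in> T ` U" "\<And>\<tau>. \<tau> \<in> U \<Longrightarrow> w \<bullet> T \<tau> = \<sigma> \<bullet> \<tau>"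
    using functional_factors_through_closed_op[OF T range_T \<sigma>(3)] by blast
  \<comment> \<open>This is the solvability condition for \<open>S* e = g - y - p\<close>; it is
    checked separately on the exact and harmonic parts of \<open>v\<close>.\<close>
  have "(g - y - p) \<bullet> v = 0" if v: "v \<in> V" "S v = 0" for v
  proof -
    obtain x h where x: "x \<in> U" "h \<in> H" "v = T x + h"
      using kernel_decomposition[OF v] by blast
    have "p \<bullet> T x = 0" using p(1) x(1) by (simp add: H_iff)
    moreover have "y \<bullet> h = 0" using y(1) x(2) by (auto simp: H_iff inner_commute)
    ultimately show ?thesis
      using p(2)[OF x(2)] y(2)[of "T x"] x by (simp add: inner_diff_left inner_add_right)
  qed
  then obtain e where e: "e \<in> S ` V" "\<And>v. v \<in> V \<Longrightarrow> e \<bullet> S v = (g - y - p) \<bullet> v"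
    using functional_factors_through_closed_op[OF S range_S, where l = "g - y - p"] by blast
  obtain w' where w': "w' \<in> V" "S w' = e" "\<And>v. v \<in> V \<Longrightarrow> S v = 0 \<Longrightarrow> w' \<bullet> v = 0"
    using preimage_orthogonal_to_kernel[OF S e(1)] by blast
  have wV: "w \<in> V" "S w = 0" using w(1) T_V S_T by auto
  have "mixed_solution g \<sigma> (w + w') p"
    unfolding mixed_solution_def
  proof (intro conjI ballI)
    show "w + w' \<in> V" using wV w' linear_S by (simp add: subspace_add)
    show "\<sigma> \<bullet> \<tau> = (w + w') \<bullet> T \<tau>" if "\<tau> \<in> U" for \<tau>
      using w(2) w'(3) T_V S_T that by (simp add: inner_add_left)
    show "T \<sigma> \<bullet> v + S (w + w') \<bullet> S v + p \<bullet> v = g \<bullet> v" if "v \<in> V" for v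
    proof -
      have "S (w + w') = e" using wV w' linear_S by (simp add: linear_op_on_def)
      then show ?thesis using e(2)[OF that] \<sigma>(2) by (simp add: inner_diff_left)
    qed
    show "(w + w') \<bullet> q = 0" if "q \<in> H" for q
    proof -
      have "w' \<bullet> q = 0" using w'(3) that by (simp add: H_iff)
      moreover have "w \<bullet> q = 0" using w(1) that by (auto simp: H_iff inner_commute)
      ultimately show ?thesis by (simp add: inner_add_left)
    qed
  qed (use p \<sigma> in auto)
  then show ?thesis by blast
qed

text \<open>Split \<open>u = w + w'\<close> with \<open>w'\<close> orthogonal to \<open>ker S\<close>: the second equation controls \<open>w'\<close>,
  the first one controls \<open>w \<in> range T\<close> by \<open>\<sigma>\<close>.\<close>

lemma mixed_solution_bounds:
  "\<exists>K. \<forall>g \<sigma> u p. mixed_solution g \<sigma> u p \<longrightarrow>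
       norm \<sigma> \<le> K * norm g \<and> norm u \<le> K * norm g \<and> norm p \<le> norm g"
proof -
  obtain c where c: "c > 0" and c_pre: "\<And>y. y \<in> T ` U \<Longrightarrow> \<exists>x\<in>U. T x = y \<and> norm x \<le> c * norm y"
    and c_le: "\<And>x. x \<in> U \<Longrightarrow> (\<And>v. v \<in> U \<Longrightarrow> T v = 0 \<Longrightarrow> x \<bullet> v = 0) \<Longrightarrow> norm x \<le> c * norm (T x)"
    using poincare_inequality[OF T range_T] by blast
  obtain e where e: "e > 0"
    and e_le: "\<And>x. x \<in> V \<Longrightarrow> (\<And>v. v \<in> V \<Longrightarrow> S v = 0 \<Longrightarrow> x \<bullet> v = 0) \<Longrightarrow> norm x \<le> e * norm (S x)"
    using poincare_inequality[OF S range_S] by metis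
  have "norm \<sigma> \<le> c * norm g \<and> norm u \<le> (c * c + e * e) * norm g \<and> norm p \<le> norm g"
    if sol: "mixed_solution g \<sigma> u p" for g \<sigma> u p
  proof -
    have a: "\<sigma> \<in> U" "u \<in> V" "p \<in> H" "p \<in> V" "S p = 0" "\<And>x. x \<in> U \<Longrightarrow> p \<bullet> T x = 0"
      and b: "\<And>\<tau>. \<tau> \<in> U \<Longrightarrow> \<sigma> \<bullet> \<tau> = u \<bullet> T \<tau>"
      and g: "\<And>v. v \<in> V \<Longrightarrow> T \<sigma> \<bullet> v + S u \<bullet> S v + p \<bullet> v = g \<bullet> v"
      and uH: "\<And>q. q \<in> H \<Longrightarrow> u \<bullet> q = 0"
      using sol by (auto simp: mixed_solution_def H_iff)
    have CS: "g \<bullet> v \<le> norm g * norm v" for v by (rule norm_cauchy_schwarz)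
    \<comment> \<open>The test functions \<open>p\<close> and \<open>T \<sigma>\<close> are
      orthogonal to each other and \<open>S\<close> vanishes on both, so each isolates one term of
      the second equation.\<close>
    have "p \<bullet> p = g \<bullet> p" using g[of p] a by (simp add: inner_commute)
    then have p: "norm p \<le> norm g" using CS[of p] by (intro norm_le_of_inner_self) auto
    have "T \<sigma> \<bullet> T \<sigma> = g \<bullet> T \<sigma>" using g[of "T \<sigma>"] a T_V S_T by simp
    then have Ts: "norm (T \<sigma>) \<le> norm g" using CS[of "T \<sigma>"] by (intro norm_le_of_inner_self) auto
    \<comment> \<open>For \<open>\<tau>\<close> in the kernel of \<open>T\<close> the first equation
      gives \<open>\<sigma> \<bullet> \<tau> = 0\<close>, the orthogonality that the Poincare
      inequality asks for.\<close>
    have "norm \<sigma> \<le> c * norm (T \<sigma>)" using a b by (intro c_le) auto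
    then have \<sigma>: "norm \<sigma> \<le> c * norm g" using Ts c by (meson mult_left_mono less_imp_le order_trans)
    obtain w' where w': "w' \<in> V" "S w' = S u" "\<And>v. v \<in> V \<Longrightarrow> S v = 0 \<Longrightarrow> w' \<bullet> v = 0"
      using preimage_orthogonal_to_kernel[OF S, of "S u"] a by blast
    define w where "w = u - w'"
    have w: "w \<in> V" "S w = 0" using a w' linear_S by (simp_all add: w_def subspace_diff linear_op_on_diff)
    obtain x h where x: "x \<in> U" "h \<in> H" "w = T x + h" using kernel_decomposition[OF w] by blast
    \<comment> \<open>The condition that \<open>u\<close> is orthogonal to \<open>H\<close> enters
      here: it removes the harmonic part of \<open>w\<close>, so that \<open>w\<close> lies in the
      range of \<open>T\<close>.\<close>
    have "w \<bullet> h = 0" using uH[OF x(2)] w'(3)[of h] x(2) by (simp add: w_def inner_diff_left H_iff)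
    moreover have "T x \<bullet> h = 0" using x by (simp add: H_iff inner_commute)
    ultimately have "h = 0" using x by (simp add: inner_add_left)
    then obtain \<tau> where \<tau>: "\<tau> \<in> U" "T \<tau> = w" "norm \<tau> \<le> c * norm w" using c_pre[of w] x by auto
    \<comment> \<open>As \<open>w'\<close> is orthogonal to the kernel of \<open>S\<close>, this
      equals \<open>u \<bullet> w\<close>; writing \<open>w = T \<tau>\<close> brings in the first
      equation.\<close>
    have "w \<bullet> w = \<sigma> \<bullet> \<tau>" using b[OF \<tau>(1)] \<tau>(2) w'(3)[OF w] by (simp add: w_def inner_diff_left)
    also have "\<dots> \<le> norm \<sigma> * norm \<tau>" by (rule norm_cauchy_schwarz)
    also have "\<dots> \<le> (c * norm g) * (c * norm w)" using \<sigma> \<tau> c by (intro mult_mono) auto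
    finally have w_le: "norm w \<le> c * c * norm g"
      using c by (intro norm_le_of_inner_self) (auto simp: mult_ac)
    have w'_le: "norm w' \<le> e * norm (S u)" using e_le[OF w'(1)] w' by simp
    \<comment> \<open>Testing with \<open>w'\<close> isolates the middle term, because
      \<open>T \<sigma>\<close> and \<open>p\<close> lie in the kernel of \<open>S\<close>.\<close>
    have "S u \<bullet> S u = g \<bullet> w'"
      using g[OF w'(1)] w'(2) w'(3)[of "T \<sigma>"] w'(3)[of p] a T_V S_T by (simp add: inner_commute)
    also have "\<dots> \<le> norm g * (e * norm (S u))"
      using CS[of w'] mult_left_mono[OF w'_le norm_ge_zero[of g]] by linarith
    finally have "norm (S u) \<le> norm g * e"
      using e by (intro norm_le_of_inner_self) (auto simp: mult_ac)
    then have "e * norm (S u) \<le> e * (norm g * e)" using e by simp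
    then have "norm w' \<le> e * e * norm g" using w'_le by (simp add: mult_ac)
    moreover have "norm u \<le> norm w + norm w'" using norm_triangle_ineq[of w w'] by (simp add: w_def)
    ultimately show ?thesis using \<sigma> p w_le by (simp add: distrib_right)
  qed
  note bnd = this
  show ?thesis
  \<comment> \<open>The sum dominates both \<open>c\<close> and \<open>c * c + e * e\<close>, so one
    constant serves for \<open>\<sigma>\<close> and \<open>u\<close>.\<close>
  proof (intro exI[of _ "c + c * c + e * e"] allI impI)
    fix g \<sigma> u p assume sol: "mixed_solution g \<sigma> u p"
    have "c * norm g \<le> (c + c * c + e * e) * norm g"
      "(c * c + e * e) * norm g \<le> (c + c * c + e * e) * norm g"
      using c e by (auto intro!: mult_right_mono)
    then show "norm \<sigma> \<le> (c + c * c + e * e) * norm g \<and> norm u \<le> (c + c * c + e * e) * norm g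
      \<and> norm p \<le> norm g"
      using bnd[OF sol] by linarith
  qed
qed

lemma mixed_solution_diff:
  assumes "mixed_solution g \<sigma> u p" "mixed_solution g' \<sigma>' u' p'"
  shows "mixed_solution (g - g') (\<sigma> - \<sigma>') (u - u') (p - p')"
  using mixed_solution_combination[OF assms, of 1 "-1"] by simp

lemma mixed_solution_unique:
  assumes "mixed_solution g \<sigma> u p" "mixed_solution g \<sigma>' u' p'"
  shows "\<sigma> = \<sigma>'" "u = u'" "p = p'"
proof -
  obtain K where K: "\<And>g \<sigma> u p. mixed_solution g \<sigma> u p \<Longrightarrow>
       norm \<sigma> \<le> K * norm g \<and> norm u \<le> K * norm g \<and> norm p \<le> norm g"
    using mixed_solution_bounds by metis
  show "\<sigma> = \<sigma>'" "u = u'" "p = p'"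
    using K[OF mixed_solution_diff[OF assms]] by auto
qed

text \<open>By linearity the a priori bound applied to differences is Lipschitz dependence on the
  data.\<close>

lemma mixed_solution_tendsto:
  assumes "\<And>n::nat. mixed_solution (gs n) (\<sigma>s n) (us n) (ps n)" "mixed_solution g \<sigma> u p"
    and "gs \<longlonglongrightarrow> g"
  shows "\<sigma>s \<longlonglongrightarrow> \<sigma>" "us \<longlonglongrightarrow> u"
proof -
  obtain K where K: "\<And>g \<sigma> u p. mixed_solution g \<sigma> u p \<Longrightarrow>
       norm \<sigma> \<le> K * norm g \<and> norm u \<le> K * norm g \<and> norm p \<le> norm g"
    using mixed_solution_bounds by metis
  note le = K[OF mixed_solution_diff[OF assms(1) assms(2)]]
  have "(\<lambda>n. K * norm (gs n - g)) \<longlonglongrightarrow> 0"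
    using assms(3) by (intro tendsto_mult_right_zero tendsto_norm_zero) (simp add: LIM_zero)
  then have "(\<lambda>n. \<sigma>s n - \<sigma>) \<longlonglongrightarrow> 0" "(\<lambda>n. us n - u) \<longlonglongrightarrow> 0"
    using le by (auto intro!: Lim_null_comparison[where g = "\<lambda>n. K * norm (gs n - g)"] always_eventually)
  then show "\<sigma>s \<longlonglongrightarrow> \<sigma>" "us \<longlonglongrightarrow> u" by (simp_all add: LIM_zero_iff)
qed

end

section \<open>The control problem\<close>

lemma L2_set_parallelogram_midpoint:
  fixes x y :: "nat \<Rightarrow> real"
  shows "(L2_set (\<lambda>i. 1/2 * x i + 1/2 * y i) A)\<^sup>2 =
    ((L2_set x A)\<^sup>2 + (L2_set y A)\<^sup>2) / 2 - (L2_set (\<lambda>i. x i - y i) A)\<^sup>2 / 4"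
proof -
  have sq: "(L2_set f A)\<^sup>2 = (\<Sum>i\<in>A. (f i)\<^sup>2)" for f :: "nat \<Rightarrow> real"
    by (simp add: L2_set_def sum_nonneg)
  have pt: "(1/2 * x i + 1/2 * y i)\<^sup>2 = ((x i)\<^sup>2 + (y i)\<^sup>2) / 2 - (x i - y i)\<^sup>2 / 4" for i
    by (simp add: power2_eq_square field_simps)
  show ?thesis
    unfolding sq pt by (simp add: sum_subtractf sum.distrib flip: sum_divide_distrib)
qed

lemma tendsto_L2_set:
  assumes "finite A" "\<And>i. i \<in> A \<Longrightarrow> ((\<lambda>n. f n i) \<longlongrightarrow> g i) F"
  shows "((\<lambda>n. L2_set (f n) A) \<longlongrightarrow> L2_set g A) F"
  unfolding L2_set_def using assms by (intro tendsto_intros) auto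

lemma bounded_linear_op_on_tendsto:
  assumes "subspace S" "bounded_linear_op_on S T" "\<And>n. X n \<in> S" "x \<in> S" "(X \<longlongrightarrow> x) F"
  shows "((\<lambda>n. T (X n)) \<longlongrightarrow> T x) F"
proof -
  obtain K where K: "\<And>x. x \<in> S \<Longrightarrow> norm (T x) \<le> K * norm x" and lin: "linear_op_on S T"
    using assms(2) by (auto simp: bounded_linear_op_on_def)
  have le: "norm (T (X n) - T x) \<le> K * norm (X n - x)" for n
    using K[of "X n - x"] assms lin by (simp add: linear_op_on_diff[OF assms(1) lin] subspace_diff)
  have lim: "((\<lambda>n. K * norm (X n - x)) \<longlongrightarrow> 0) F"
    using assms(5) by (intro tendsto_mult_right_zero tendsto_norm_zero) (simp add: LIM_zero)
  have "((\<lambda>n. T (X n) - T x) \<longlongrightarrow> 0) F"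
    by (rule Lim_null_comparison[OF _ lim]) (simp add: le)
  then show ?thesis by (simp add: LIM_zero_iff)
qed

text \<open>The Euclidean carrier is itself closed in the product topology, so \<open>A\<close> is
  closed there too, and convergence in a product is coordinatewise.\<close>

lemma closedin_Euclidean_space_sequentially:
  assumes "closedin (Euclidean_space m) A" "\<And>n::nat. x n \<in> A" "\<And>i. (\<lambda>n. x n i) \<longlonglongrightarrow> a i"
  shows "a \<in> A"
proof -
  have "closedin (powertop_real UNIV) A"
    using closedin_trans_full[OF assms(1)[unfolded Euclidean_space_def]
        closedin_Euclidean_space[of m, unfolded topspace_Euclidean_space]] .
  moreover have "limitin (powertop_real UNIV) x a sequentially"
    using assms(3) by (auto simp: limitin_componentwise)
  ultimately show ?thesis
    using limitin_closedin[of _ x a sequentially A] assms(2) by auto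
qed

lemma Rn_isomorphism_sum:
  assumes "Rn_isomorphism H n T" "subspace H" "\<And>i. i \<in> I \<Longrightarrow> e i \<in> H" "finite I"
  shows "T (\<Sum>i\<in>I. c i *\<^sub>R e i) = (\<lambda>j. \<Sum>i\<in>I. c i * T (e i) j)"
  using assms(4,3)
proof (induction I rule: finite_induct)
  case empty
  have "T (0 *\<^sub>R 0) = (\<lambda>j. 0 * T 0 j)"
    using assms(1) subspace_0[OF assms(2)] unfolding Rn_isomorphism_def by blast
  then show ?case by simp
next
  case (insert i I)
  have "(\<Sum>i\<in>I. c i *\<^sub>R e i) \<in> H" "c i *\<^sub>R e i \<in> H"
    using insert assms(2) by (auto intro: subspace_sum subspace_scale)
  then have "T (c i *\<^sub>R e i + (\<Sum>i\<in>I. c i *\<^sub>R e i)) = (\<lambda>j. T (c i *\<^sub>R e i) j + T (\<Sum>i\<in>I. c i *\<^sub>R e i) j)"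
    using assms(1) by (simp add: Rn_isomorphism_def)
  moreover have "T (c i *\<^sub>R e i) = (\<lambda>j. c i * T (e i) j)"
    using assms(1) insert by (simp add: Rn_isomorphism_def)
  ultimately show ?case using insert by simp
qed

text \<open>The preimages of the unit vectors form the basis dual to the coordinates of
  \<open>T\<close>. Expanding in it gives continuity of the inverse of \<open>T\<close>, and shows
  that the first \<open>n\<close> coordinates determine \<open>h\<close>.\<close>

lemma Rn_isomorphism_basis:
  assumes iso: "Rn_isomorphism H n T" and H: "subspace H"
  obtains e where "\<And>i. i < n \<Longrightarrow> e i \<in> H" "\<And>h. h \<in> H \<Longrightarrow> h = (\<Sum>i<n. T h i *\<^sub>R e i)"
proof -
  have bij: "bij_betw T H (Rn n)" using iso by (simp add: Rn_isomorphism_def)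
  define \<delta> where "\<delta> i j = (if i = j then 1 else 0 :: real)" for i j :: nat
  have "\<exists>x\<in>H. T x = \<delta> i" if "i < n" for i
  proof -
    have "\<delta> i \<in> Rn n" using that by (auto simp: topspace_Euclidean_space \<delta>_def)
    then show ?thesis using bij by (metis bij_betw_imp_surj_on imageE)
  qed
  then obtain e where e: "\<And>i. i < n \<Longrightarrow> e i \<in> H" "\<And>i. i < n \<Longrightarrow> T (e i) = \<delta> i" by metis
  show ?thesis
  proof (rule that[OF e(1)])
    fix h assume h: "h \<in> H"
    have "T h \<in> Rn n" using bij h by (metis bij_betwE)
    then have zero: "T h j = 0" if "j \<ge> n" for j using that by (simp add: topspace_Euclidean_space)
    have "T (\<Sum>i<n. T h i *\<^sub>R e i) = (\<lambda>j. \<Sum>i<n. T h i * T (e i) j)"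
      using e by (intro Rn_isomorphism_sum[OF iso H]) auto
    also have "\<dots> = T h"
    proof
      fix j
      have "(\<Sum>i<n. T h i * T (e i) j) = (\<Sum>i<n. if i = j then T h i else 0)"
        using e(2) by (intro sum.cong) (auto simp: \<delta>_def)
      then show "(\<Sum>i<n. T h i * T (e i) j) = T h j" using zero by auto
    qed
    finally have "T (\<Sum>i<n. T h i *\<^sub>R e i) = T h" .
    moreover have "(\<Sum>i<n. T h i *\<^sub>R e i) \<in> H" using e H by (auto intro!: subspace_sum subspace_scale)
    ultimately show "h = (\<Sum>i<n. T h i *\<^sub>R e i)"
      using bij h unfolding bij_betw_def inj_on_def by metis
  qed
qed

text \<open>Splitting \<open>b\<close> into two halves makes the residual at the midpoint the mean
  of the two residuals; the parallelogram gap is then dropped.\<close>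

lemma norm_squared_affine_midpoint_le:
  fixes T :: "'a::real_vector \<Rightarrow> 'b::real_inner"
  assumes "subspace S" "linear_op_on S T" "x \<in> S" "y \<in> S"
  shows "(norm (T ((1/2) *\<^sub>R x + (1/2) *\<^sub>R y) - b))\<^sup>2 \<le> ((norm (T x - b))\<^sup>2 + (norm (T y - b))\<^sup>2) / 2"
proof -
  have "T ((1/2) *\<^sub>R x + (1/2) *\<^sub>R y) = (1/2) *\<^sub>R T x + (1/2) *\<^sub>R T y"
    using assms by (simp add: linear_op_on_def subspace_scale)
  moreover have "b = (1/2) *\<^sub>R b + (1/2) *\<^sub>R b" by (simp flip: scaleR_left.add)
  ultimately have eq: "T ((1/2) *\<^sub>R x + (1/2) *\<^sub>R y) - b = (1/2) *\<^sub>R ((T x - b) + (T y - b))"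
    by (simp add: algebra_simps)
  show ?thesis
    unfolding eq parallelogram_midpoint using zero_le_power2[of "norm (T x - b - (T y - b))"] by argo
qed

section \<open>The control-to-state map: well-posedness, affinity and continuity\<close>

locale hodge_control =
  fixes W V :: "int \<Rightarrow> 'w::{real_inner,complete_space} set"
    and d :: "int \<Rightarrow> 'w \<Rightarrow> 'w"
    and k :: int and m :: nat
    and B :: "'z::{real_inner,complete_space} \<Rightarrow> 'w"
    and Ob :: "'w \<Rightarrow> 'y::{real_inner,complete_space}"
    and R :: "'w \<Rightarrow> 's::{real_inner,complete_space}"
    and \<Pi>H :: "'w \<Rightarrow> nat \<Rightarrow> real"
    and G :: "nat \<Rightarrow> nat \<Rightarrow> real"
    and f :: 'w and yd :: 'y and rd :: 's
    and \<pi>d c0 :: "nat \<Rightarrow> real"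
    and wy w\<sigma> w\<Pi> \<alpha> \<alpha>top :: real
  assumes complex: "closed_hilbert_complex W V d"
    and B: "bounded_linear B"
    and Ob: "bounded_linear_op_on (W k) Ob"
    and R: "bounded_linear_op_on (W (k - 1)) R"
    and iso: "Rn_isomorphism (harmonic V d k) (betti V d k) \<Pi>H"
    and weights: "wy \<ge> 0" "w\<sigma> \<ge> 0" "w\<Pi> \<ge> 0" "\<alpha> > 0" "\<alpha>top > 0"
begin

abbreviation S where "S \<equiv> state_system V d k m B \<Pi>H G f c0"
abbreviation J where "J \<equiv> cost V d k m Ob R \<Pi>H yd rd \<pi>d wy w\<sigma> w\<Pi> \<alpha> \<alpha>top"
abbreviation b where "b \<equiv> betti V d k"

lemma closed_op_d: "closed_op_on (V j) (d j)"
  and range_d: "closed (d j ` V j)"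
  and VW: "V j \<subseteq> W j" and W: "subspace (W j)"
  and d_V: "x \<in> V j \<Longrightarrow> d j x \<in> V (j + 1)" and d_d: "x \<in> V j \<Longrightarrow> d (j + 1) (d j x) = 0"
proof -
  show "closed (d j ` V j)"
    using complex unfolding closed_hilbert_complex_def by (metis add_diff_cancel)
qed (use complex in \<open>auto simp: closed_hilbert_complex_def hilbert_complex_def closed_op_on_def\<close>)

sublocale seg: closed_complex_segment "V (k - 1)" "d (k - 1)" "V k" "d k"
  using closed_op_d range_d d_V[of _ "k - 1"] d_d[of _ "k - 1"] by unfold_locales auto

lemma harmonic_eq: "harmonic V d k = seg.H"
  by (simp add: harmonic_def seg.H_def)

definition target :: "(nat \<Rightarrow> real) \<Rightarrow> nat \<Rightarrow> real" where
  "target a i = (\<Sum>j<m. G i j * a j) + c0 i"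

text \<open>The decoupling: the mixed problem involves only \<open>z\<close>, the coordinate
  equation only \<open>a\<close>.\<close>

lemma state_system_iff:
  "S \<sigma> u p h z a \<longleftrightarrow>
     seg.mixed_solution (f + B z) \<sigma> u p \<and> h \<in> seg.H \<and> (\<forall>i<b. \<Pi>H h i = target a i)"
  by (auto simp: state_system_def seg.mixed_solution_def harmonic_eq target_def)

lemma iso_H: "Rn_isomorphism seg.H b \<Pi>H"
  using iso by (simp add: harmonic_eq)

lemma coords_exist: "\<exists>h\<in>seg.H. \<forall>i<b. \<Pi>H h i = y i"
proof -
  have "\<Pi>H ` seg.H = Rn b"
    using iso_H by (simp add: Rn_isomorphism_def bij_betw_def)
  \<comment> \<open>Padding with zeros puts an arbitrary \<open>y\<close> into the carrier without
    changing the entries that matter.\<close>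
  then have "(\<lambda>i. if i < b then y i else 0) \<in> \<Pi>H ` seg.H" by (simp add: topspace_Euclidean_space)
  then obtain h where h: "h \<in> seg.H" "(\<lambda>i. if i < b then y i else 0) = \<Pi>H h" by (elim imageE)
  show ?thesis
    by (rule bexI[OF _ h(1)]) (simp flip: h(2))
qed

lemma coords_unique:
  assumes "h \<in> seg.H" "h' \<in> seg.H" "\<And>i. i < b \<Longrightarrow> \<Pi>H h i = \<Pi>H h' i"
  shows "h = h'"
proof -
  obtain e where e: "\<And>h. h \<in> seg.H \<Longrightarrow> h = (\<Sum>i<b. \<Pi>H h i *\<^sub>R e i)"
    using Rn_isomorphism_basis[OF iso_H seg.subspace_H] by metis
  have "(\<Sum>i<b. \<Pi>H h i *\<^sub>R e i) = (\<Sum>i<b. \<Pi>H h' i *\<^sub>R e i)"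
    using assms(3) by (intro sum.cong) auto
  then show ?thesis using e[OF assms(1)] e[OF assms(2)] by simp
qed

lemma state_exists: "\<exists>\<sigma> u p h. S \<sigma> u p h z a"
proof -
  obtain \<sigma> u p where "seg.mixed_solution (f + B z) \<sigma> u p"
    using seg.mixed_solution_exists by blast
  moreover obtain h where "h \<in> seg.H" "\<forall>i<b. \<Pi>H h i = target a i"
    using coords_exist by blast
  ultimately show ?thesis unfolding state_system_iff by blast
qed

lemma state_unique:
  assumes "S \<sigma> u p h z a" "S \<sigma>' u' p' h' z a"
  shows "\<sigma> = \<sigma>'" "u = u'" "p = p'" "h = h'"
proof -
  have sol: "seg.mixed_solution (f + B z) \<sigma> u p" "seg.mixed_solution (f + B z) \<sigma>' u' p'"
    and h: "h \<in> seg.H" "h' \<in> seg.H" "\<And>i. i < b \<Longrightarrow> \<Pi>H h i = \<Pi>H h' i"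
    using assms by (simp_all add: state_system_iff)
  show "\<sigma> = \<sigma>'" "u = u'" "p = p'" by (rule seg.mixed_solution_unique[OF sol])+
  show "h = h'" by (rule coords_unique[OF h])
qed

text \<open>Places the arguments of \<open>Ob\<close> and \<open>R\<close> in the subspaces on which
  these operators are assumed linear and bounded.\<close>

lemma state_in_W:
  assumes "S \<sigma> u p h z a"
  shows "\<sigma> \<in> W (k - 1)" "u + h \<in> W k" "h \<in> seg.H"
  using assms VW[of "k - 1"] VW[of k] W[of k]
  by (auto simp: state_system_iff seg.mixed_solution_def seg.H_iff intro!: subspace_add)

lemma state_midpoint:
  assumes "S \<sigma> u p h z a" "S \<sigma>' u' p' h' z' a'"
  defines "mid \<equiv> \<lambda>x y :: 'w. (1/2) *\<^sub>R x + (1/2) *\<^sub>R y"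
  shows "S (mid \<sigma> \<sigma>') (mid u u') (mid p p') (mid h h') ((1/2) *\<^sub>R (z + z'))
    (\<lambda>j. 1/2 * a j + 1/2 * a' j)"
proof -
  interpret B: bounded_linear B by (rule B)
  have H: "h \<in> seg.H" "h' \<in> seg.H" "(1/2) *\<^sub>R h \<in> seg.H" "(1/2) *\<^sub>R h' \<in> seg.H"
    using assms seg.subspace_H by (auto simp: state_system_iff subspace_scale)
  then have "mid h h' \<in> seg.H"
    unfolding mid_def using seg.subspace_H by (intro subspace_add)
  moreover have "\<Pi>H (mid h h') = (\<lambda>i. 1/2 * \<Pi>H h i + 1/2 * \<Pi>H h' i)"
    unfolding mid_def using H iso_H by (simp add: Rn_isomorphism_def)
  moreover have "target (\<lambda>j. 1/2 * a j + 1/2 * a' j) i = 1/2 * target a i + 1/2 * target a' i" for i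
    by (simp add: target_def sum.distrib sum_distrib_left algebra_simps)
  \<comment> \<open>The constants \<open>f\<close> and \<open>c0\<close> survive averaging because
    the two weights add up to 1: the state map is affine, not linear.\<close>
  moreover have "f = (1/2) *\<^sub>R f + (1/2) *\<^sub>R f" by (simp flip: scaleR_left.add)
  then have "f + B ((1/2) *\<^sub>R (z + z')) = mid (f + B z) (f + B z')"
    by (simp add: B.add B.scaleR mid_def algebra_simps)
  ultimately show ?thesis
    using assms(1,2) seg.mixed_solution_combination unfolding state_system_iff mid_def by simp
qed

text \<open>The mixed solution depends continuously on \<open>B z\<close>. For \<open>h\<close> only
  the coordinates are known to converge, and expansion in the dual basis turns this into convergence
  in norm.\<close>

lemma state_tendsto:
  assumes S: "\<And>n. S (\<sigma>s n) (us n) (ps n) (hs n) (zs n) (as n)" "S \<sigma> u p h z a"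
    and lim: "zs \<longlonglongrightarrow> z" "\<And>j. j < m \<Longrightarrow> (\<lambda>n. as n j) \<longlonglongrightarrow> a j"
  shows "\<sigma>s \<longlonglongrightarrow> \<sigma>" "us \<longlonglongrightarrow> u" "hs \<longlonglongrightarrow> h"
    "i < b \<Longrightarrow> (\<lambda>n. \<Pi>H (hs n) i) \<longlonglongrightarrow> \<Pi>H h i"
proof -
  have sols: "\<And>n. seg.mixed_solution (f + B (zs n)) (\<sigma>s n) (us n) (ps n)"
    and sol: "seg.mixed_solution (f + B z) \<sigma> u p"
    using S by (simp_all add: state_system_iff)
  have "(\<lambda>n. f + B (zs n)) \<longlonglongrightarrow> f + B z"
    by (intro tendsto_intros bounded_linear.tendsto[OF B] lim)
  from seg.mixed_solution_tendsto[OF sols sol this]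
  show "\<sigma>s \<longlonglongrightarrow> \<sigma>" "us \<longlonglongrightarrow> u" .
  have coord: "(\<lambda>n. \<Pi>H (hs n) i) \<longlonglongrightarrow> \<Pi>H h i" if "i < b" for i
  proof -
    have "(\<lambda>n. target (as n) i) \<longlonglongrightarrow> target a i"
      unfolding target_def by (intro tendsto_intros lim) auto
    then show ?thesis using S that by (simp add: state_system_iff)
  qed
  then show "i < b \<Longrightarrow> (\<lambda>n. \<Pi>H (hs n) i) \<longlonglongrightarrow> \<Pi>H h i" .
  obtain e where e: "\<And>h. h \<in> seg.H \<Longrightarrow> h = (\<Sum>i<b. \<Pi>H h i *\<^sub>R e i)"
    using Rn_isomorphism_basis[OF iso_H seg.subspace_H] by metis
  have "(\<lambda>n. \<Sum>i<b. \<Pi>H (hs n) i *\<^sub>R e i) \<longlonglongrightarrow> (\<Sum>i<b. \<Pi>H h i *\<^sub>R e i)"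
    by (intro tendsto_sum tendsto_scaleR tendsto_const coord) auto
  moreover have "hs n = (\<Sum>i<b. \<Pi>H (hs n) i *\<^sub>R e i)" "h = (\<Sum>i<b. \<Pi>H h i *\<^sub>R e i)" for n
    by (rule e, use S in \<open>simp add: state_system_iff\<close>)+
  ultimately show "hs \<longlonglongrightarrow> h" by simp
qed

section \<open>Continuity and strong convexity of the cost along states\<close>

lemma cost_tendsto:
  assumes S: "\<And>n. S (\<sigma>s n) (us n) (ps n) (hs n) (zs n) (as n)" "S \<sigma> u p h z a"
    and lim: "zs \<longlonglongrightarrow> z" "\<And>j. j < m \<Longrightarrow> (\<lambda>n. as n j) \<longlonglongrightarrow> a j"
  shows "(\<lambda>n. J (\<sigma>s n) (us n) (hs n) (zs n) (as n)) \<longlonglongrightarrow> J \<sigma> u h z a"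
proof -
  note st = state_tendsto[OF S lim]
  have "(\<lambda>n. Ob (us n + hs n)) \<longlonglongrightarrow> Ob (u + h)"
    by (rule bounded_linear_op_on_tendsto[OF W Ob])
      (use S state_in_W in \<open>blast intro: tendsto_add st\<close>)+
  moreover have "(\<lambda>n. R (\<sigma>s n)) \<longlonglongrightarrow> R \<sigma>"
    by (rule bounded_linear_op_on_tendsto[OF W R]) (use S state_in_W st in blast)+
  ultimately show ?thesis
    unfolding cost_def by (intro tendsto_intros tendsto_L2_set st lim) auto
qed

text \<open>The convexity gap of the two control terms: the cost factors \<open>\<alpha> / 2\<close>
  and \<open>\<alpha>top / 2\<close> times the quarter from the parallelogram identity.\<close>

definition ctrl_dist :: "'z \<times> (nat \<Rightarrow> real) \<Rightarrow> 'z \<times> (nat \<Rightarrow> real) \<Rightarrow> real" where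
  "ctrl_dist x y = \<alpha> / 8 * (norm (fst x - fst y))\<^sup>2 +
     \<alpha>top / 8 * (Rn_norm m (\<lambda>i. snd x i - snd y i))\<^sup>2"

text \<open>The tracking terms are convex with nonnegative weights, so their gaps are discarded; the
  two control terms satisfy the parallelogram identity exactly and supply
  \<open>ctrl_dist\<close>.\<close>

lemma cost_midpoint:
  assumes "S \<sigma> u p h z a" "S \<sigma>' u' p' h' z' a'"
  defines "mid \<equiv> \<lambda>x y :: 'w. (1/2) *\<^sub>R x + (1/2) *\<^sub>R y"
  shows "J (mid \<sigma> \<sigma>') (mid u u') (mid h h') ((1/2) *\<^sub>R (z + z')) (\<lambda>j. 1/2 * a j + 1/2 * a' j)
    \<le> (J \<sigma> u h z a + J \<sigma>' u' h' z' a') / 2 - ctrl_dist (z, a) (z', a')"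
proof -
  have lin: "linear_op_on (W k) Ob" "linear_op_on (W (k - 1)) R"
    using Ob R by (auto simp: bounded_linear_op_on_def)
  have "mid u u' + mid h h' = (1/2) *\<^sub>R (u + h) + (1/2) *\<^sub>R (u' + h')"
    by (simp add: mid_def algebra_simps)
  then have 1: "(norm (Ob (mid u u' + mid h h') - yd))\<^sup>2
      \<le> ((norm (Ob (u + h) - yd))\<^sup>2 + (norm (Ob (u' + h') - yd))\<^sup>2) / 2" (is "?n1 \<le> ?r1")
    using norm_squared_affine_midpoint_le[OF W lin(1) state_in_W(2)[OF assms(1)] state_in_W(2)[OF assms(2)]]
    by simp
  have 2: "(norm (R (mid \<sigma> \<sigma>') - rd))\<^sup>2
      \<le> ((norm (R \<sigma> - rd))\<^sup>2 + (norm (R \<sigma>' - rd))\<^sup>2) / 2" (is "?n2 \<le> ?r2")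
    using norm_squared_affine_midpoint_le[OF W lin(2) state_in_W(1)[OF assms(1)] state_in_W(1)[OF assms(2)]]
    by (simp add: mid_def)
  have H: "h \<in> seg.H" "h' \<in> seg.H" "(1/2) *\<^sub>R h \<in> seg.H" "(1/2) *\<^sub>R h' \<in> seg.H"
    using assms seg.subspace_H by (auto simp: state_system_iff subspace_scale)
  then have "\<Pi>H (mid h h') = (\<lambda>i. 1/2 * \<Pi>H h i + 1/2 * \<Pi>H h' i)"
    unfolding mid_def using iso_H by (simp add: Rn_isomorphism_def)
  then have eq: "(\<lambda>i. \<Pi>H (mid h h') i - \<pi>d i) = (\<lambda>i. 1/2 * (\<Pi>H h i - \<pi>d i) + 1/2 * (\<Pi>H h' i - \<pi>d i))"
    by (auto simp: field_simps)
  have 3: "(Rn_norm b (\<lambda>i. \<Pi>H (mid h h') i - \<pi>d i))\<^sup>2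
      \<le> ((Rn_norm b (\<lambda>i. \<Pi>H h i - \<pi>d i))\<^sup>2 + (Rn_norm b (\<lambda>i. \<Pi>H h' i - \<pi>d i))\<^sup>2) / 2" (is "?n3 \<le> ?r3")
    unfolding eq L2_set_parallelogram_midpoint
    using zero_le_power2[of "Rn_norm b (\<lambda>i. \<Pi>H h i - \<pi>d i - (\<Pi>H h' i - \<pi>d i))"] by argo
  have le: "wy / 2 * ?n1 \<le> wy / 2 * ?r1" "w\<sigma> / 2 * ?n2 \<le> w\<sigma> / 2 * ?r2" "w\<Pi> / 2 * ?n3 \<le> w\<Pi> / 2 * ?r3"
    using 1 2 3 weights by (intro mult_left_mono; simp)+
  show ?thesis
    unfolding cost_def ctrl_dist_def parallelogram_midpoint L2_set_parallelogram_midpoint fst_conv snd_conv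
    using le by argo
qed

text \<open>The state is given by a relation, so a value is chosen; existence and uniqueness of
  states make the choice unambiguous.\<close>

definition reduced_cost :: "'z \<times> (nat \<Rightarrow> real) \<Rightarrow> real" where
  "reduced_cost x = (SOME r. \<exists>\<sigma> u p h. S \<sigma> u p h (fst x) (snd x) \<and> r = J \<sigma> u h (fst x) (snd x))"

lemma reduced_cost_eq:
  assumes "S \<sigma> u p h z a"
  shows "reduced_cost (z, a) = J \<sigma> u h z a"
  unfolding reduced_cost_def fst_conv snd_conv
proof (rule some_equality)
  show "\<exists>\<sigma>' u' p' h'. S \<sigma>' u' p' h' z a \<and> J \<sigma> u h z a = J \<sigma>' u' h' z a"
    using assms by blast
  show "r = J \<sigma> u h z a" if "\<exists>\<sigma> u p h. S \<sigma> u p h z a \<and> r = J \<sigma> u h z a" for r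
    using that state_unique[OF assms] by blast
qed

text \<open>Each control carries exactly one state, so comparing feasible tuples amounts to
  comparing controls.\<close>

lemma optimal_iff:
  "(\<exists>\<sigma> u p h. optimal S J Zad Aad \<sigma> u p h z a) \<longleftrightarrow>
     (z, a) \<in> Zad \<times> Aad \<and> (\<forall>y\<in>Zad \<times> Aad. reduced_cost (z, a) \<le> reduced_cost y)" (is "?L \<longleftrightarrow> ?R")
proof
  assume ?L
  then obtain \<sigma> u p h where o: "z \<in> Zad" "a \<in> Aad" "S \<sigma> u p h z a"
    "\<And>\<sigma>' u' p' h' z' a'. z' \<in> Zad \<Longrightarrow> a' \<in> Aad \<Longrightarrow> S \<sigma>' u' p' h' z' a' \<Longrightarrow>
        J \<sigma> u h z a \<le> J \<sigma>' u' h' z' a'"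
    unfolding optimal_def by blast
  have "reduced_cost (z, a) \<le> reduced_cost (z', a')" if "z' \<in> Zad" "a' \<in> Aad" for z' a'
  proof -
    obtain \<sigma>' u' p' h' where s: "S \<sigma>' u' p' h' z' a'" using state_exists by blast
    show ?thesis using o(4)[OF that s] by (simp add: reduced_cost_eq[OF s] reduced_cost_eq[OF o(3)])
  qed
  then show ?R using o by auto
next
  assume r: ?R
  obtain \<sigma> u p h where s: "S \<sigma> u p h z a" using state_exists by blast
  have "J \<sigma> u h z a \<le> J \<sigma>' u' h' z' a'" if "z' \<in> Zad" "a' \<in> Aad" "S \<sigma>' u' p' h' z' a'"
    for \<sigma>' u' p' h' z' a'
    using r that by (auto simp: reduced_cost_eq[OF s, symmetric] reduced_cost_eq[OF that(3), symmetric])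
  then show ?L unfolding optimal_def using r s by blast
qed

text \<open>\<open>ctrl_dist\<close> dominates multiples of the squared distance in \<open>z\<close>
  and of each squared coordinate difference below \<open>m\<close>. A Cauchy sequence for it
  therefore converges in norm in \<open>z\<close> and coordinatewise in \<open>a\<close>, which
  suffices for continuity of the cost.\<close>

lemma ex1_reduced_minimizer:
  assumes Z: "Zad \<noteq> {}" "closed Zad" "convex Zad"
    and A: "Aad \<noteq> {}" "closedin (Euclidean_space m) Aad" "Rn_convex Aad"
  shows "\<exists>!x. x \<in> Zad \<times> Aad \<and> (\<forall>y\<in>Zad \<times> Aad. reduced_cost x \<le> reduced_cost y)"
proof (rule ex1_minimizer_of_strong_midpoint_convexity[where D = ctrl_dist and L = 0])
  have zero: "a i = 0" if "a \<in> Aad" "i \<ge> m" for a i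
    using closedin_subset[OF A(2)] that by (auto simp: topspace_Euclidean_space)
  have sq: "(Rn_norm m v)\<^sup>2 = (\<Sum>i<m. (v i)\<^sup>2)" for v
    by (simp add: L2_set_def sum_nonneg)
  show "Zad \<times> Aad \<noteq> {}" using Z A by simp
  show "0 \<le> reduced_cost x" for x
  proof -
    obtain \<sigma> u p h where s: "S \<sigma> u p h (fst x) (snd x)" using state_exists by blast
    show ?thesis
      using reduced_cost_eq[OF s] weights by (simp add: cost_def)
  qed
  show "\<exists>w\<in>Zad \<times> Aad. reduced_cost w \<le> (reduced_cost x + reduced_cost y) / 2 - ctrl_dist x y"
    if xy: "x \<in> Zad \<times> Aad" "y \<in> Zad \<times> Aad" for x y
  proof -
    obtain z a z' a' where [simp]: "x = (z, a)" "y = (z', a')" by (cases x, cases y)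
    obtain \<sigma> u p h where s: "S \<sigma> u p h z a" using state_exists by blast
    obtain \<sigma>' u' p' h' where s': "S \<sigma>' u' p' h' z' a'" using state_exists by blast
    have "(1/2) *\<^sub>R (z + z') \<in> Zad"
      using convexD[OF Z(3), of z z' "1/2" "1/2"] xy by (simp add: scaleR_add_right)
    moreover have "(\<lambda>j. 1/2 * a j + 1/2 * a' j) \<in> Aad"
      using A(3)[unfolded Rn_convex_def, rule_format, of a a' "1/2" "1/2"] xy by simp
    ultimately show ?thesis
      using cost_midpoint[OF s s'] reduced_cost_eq[OF s] reduced_cost_eq[OF s']
        reduced_cost_eq[OF state_midpoint[OF s s']]
      by (intro bexI[of _ "((1/2) *\<^sub>R (z + z'), \<lambda>j. 1/2 * a j + 1/2 * a' j)"]) auto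
  qed
  show "x = y" if xy: "x \<in> Zad \<times> Aad" "y \<in> Zad \<times> Aad" and D: "ctrl_dist x y \<le> 0" for x y
  proof -
    have "0 \<le> \<alpha> / 8 * (norm (fst x - fst y))\<^sup>2"
      "0 \<le> \<alpha>top / 8 * (Rn_norm m (\<lambda>i. snd x i - snd y i))\<^sup>2"
      using weights by auto
    then have "\<alpha> / 8 * (norm (fst x - fst y))\<^sup>2 = 0"
      "\<alpha>top / 8 * (Rn_norm m (\<lambda>i. snd x i - snd y i))\<^sup>2 = 0"
      using D unfolding ctrl_dist_def by linarith+
    then have eq: "fst x = fst y" "(Rn_norm m (\<lambda>i. snd x i - snd y i))\<^sup>2 = 0"
      using weights by auto
    \<comment> \<open>A vanishing \<open>Rn_norm m\<close> settles the indices below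
      \<open>m\<close>; from \<open>m\<close> on all members of \<open>Aad\<close> are zero.\<close>
    have "snd x i = snd y i" for i
      using eq(2) zero[of "snd x" i] zero[of "snd y" i] xy unfolding sq
      by (cases "i < m") (auto simp: sum_nonneg_eq_0_iff)
    with eq(1) show ?thesis by (simp add: prod_eq_iff fun_eq_iff)
  qed
  fix X :: "nat \<Rightarrow> 'z \<times> (nat \<Rightarrow> real)"
  assume X: "\<And>n. X n \<in> Zad \<times> Aad"
    and C: "\<And>e. 0 < e \<Longrightarrow> \<exists>N. \<forall>i\<ge>N. \<forall>j\<ge>N. ctrl_dist (X i) (X j) < e"
  define zs as where "zs = fst \<circ> X" and "as = snd \<circ> X"
  have XC: "zs n \<in> Zad" "as n \<in> Aad" for n
    using X[of n] by (auto simp: zs_def as_def mem_Times_iff)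
  have "Cauchy zs"
  proof (rule Cauchy_of_norm_squared[where c = "\<alpha> / 8"])
    fix e :: real assume "e > 0"
    have "\<alpha> / 8 * (norm (zs i - zs j))\<^sup>2 \<le> ctrl_dist (X i) (X j)" for i j
      using weights by (simp add: ctrl_dist_def zs_def)
    then show "\<exists>N. \<forall>i\<ge>N. \<forall>j\<ge>N. \<alpha> / 8 * (norm (zs i - zs j))\<^sup>2 < e"
      using C[OF \<open>e > 0\<close>] by (meson le_less_trans)
  qed (use weights in simp)
  then obtain z where z: "zs \<longlonglongrightarrow> z"
    using Cauchy_convergent_iff convergent_def by blast
  \<comment> \<open>Limits are needed at every index, since the limit vector must be a point of the
    product space; from \<open>m\<close> on the sequence is constantly 0.\<close>
  have "\<exists>l. (\<lambda>n. as n j) \<longlonglongrightarrow> l" for j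
  proof (cases "j < m")
    case True
    have "Cauchy (\<lambda>n. as n j)"
    proof (rule Cauchy_of_norm_squared[where c = "\<alpha>top / 8"])
      fix e :: real assume "e > 0"
      have "\<alpha>top / 8 * (norm (as i j - as i' j))\<^sup>2 \<le> ctrl_dist (X i) (X i')" for i i'
      proof -
        have "(norm (as i j - as i' j))\<^sup>2 \<le> (Rn_norm m (\<lambda>l. as i l - as i' l))\<^sup>2"
          unfolding sq using True member_le_sum[of j "{..<m}" "\<lambda>l. (as i l - as i' l)\<^sup>2"] by simp
        then have "\<alpha>top / 8 * (norm (as i j - as i' j))\<^sup>2
            \<le> \<alpha>top / 8 * (Rn_norm m (\<lambda>l. as i l - as i' l))\<^sup>2"
          using weights by (intro mult_left_mono) auto
        moreover have "0 \<le> \<alpha> / 8 * (norm (zs i - zs i'))\<^sup>2" using weights by simp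
        ultimately show ?thesis unfolding ctrl_dist_def zs_def as_def comp_def by linarith
      qed
      then show "\<exists>N. \<forall>i\<ge>N. \<forall>i'\<ge>N. \<alpha>top / 8 * (norm (as i j - as i' j))\<^sup>2 < e"
        using C[OF \<open>e > 0\<close>] by (meson le_less_trans)
    qed (use weights in simp)
    then show ?thesis using Cauchy_convergent_iff convergent_def by blast
  next
    case False
    then have "(\<lambda>n. as n j) = (\<lambda>n. 0)" using zero XC by auto
    then show ?thesis by auto
  qed
  then obtain a where a: "\<And>j. (\<lambda>n. as n j) \<longlonglongrightarrow> a j" by metis
  have za: "z \<in> Zad" "a \<in> Aad"
    using closed_sequentially[OF Z(2) XC(1) z] closedin_Euclidean_space_sequentially[OF A(2) XC(2) a]
    by auto
  have "\<forall>n. \<exists>\<sigma> u p h. S \<sigma> u p h (zs n) (as n)" using state_exists by blast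
  then obtain \<sigma>s us ps hs where ss: "\<And>n. S (\<sigma>s n) (us n) (ps n) (hs n) (zs n) (as n)" by metis
  obtain \<sigma> u p h where s: "S \<sigma> u p h z a" using state_exists by blast
  have "X n = (zs n, as n)" for n by (simp add: zs_def as_def)
  then have "(\<lambda>n. reduced_cost (X n)) \<longlonglongrightarrow> reduced_cost (z, a)"
    using cost_tendsto[OF ss s z a] by (simp add: reduced_cost_eq[OF ss] reduced_cost_eq[OF s])
  with za show "\<exists>x\<in>Zad \<times> Aad. (\<lambda>n. reduced_cost (X n)) \<longlonglongrightarrow> reduced_cost x" by blast
qed

end

theorem theorem4p1:
  fixes W V :: "int \<Rightarrow> 'w::{real_inner,complete_space} set"
    and d :: "int \<Rightarrow> 'w \<Rightarrow> 'w"
    and k :: int and m :: nat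
    and B :: "'z::{real_inner,complete_space} \<Rightarrow> 'w"
    and Ob :: "'w \<Rightarrow> 'y::{real_inner,complete_space}"
    and R :: "'w \<Rightarrow> 's::{real_inner,complete_space}"
    and \<Pi>H :: "'w \<Rightarrow> nat \<Rightarrow> real"
    and G :: "nat \<Rightarrow> nat \<Rightarrow> real"
    and f :: 'w and yd :: 'y and rd :: 's
    and \<pi>d c0 :: "nat \<Rightarrow> real"
    and wy w\<sigma> w\<Pi> \<alpha> \<alpha>top :: real
    and Zad :: "'z set" and Aad :: "(nat \<Rightarrow> real) set"
  defines "S \<equiv> state_system V d k m B \<Pi>H G f c0"
    and "J \<equiv> cost V d k m Ob R \<Pi>H yd rd \<pi>d wy w\<sigma> w\<Pi> \<alpha> \<alpha>top"
  assumes "closed_hilbert_complex W V d"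
    and "\<exists>E. finite E \<and> span E = harmonic V d k"
    and "bounded_linear B" and "range B \<subseteq> W k"
    and "bounded_linear_op_on (W k) Ob"
    and "bounded_linear_op_on (W (k - 1)) R"
    and "Rn_isomorphism (harmonic V d k) (betti V d k) \<Pi>H"
    and "f \<in> W k"
    and "\<pi>d \<in> Rn (betti V d k)" and "c0 \<in> Rn (betti V d k)"
    and "wy \<ge> 0" and "w\<sigma> \<ge> 0" and "w\<Pi> \<ge> 0"
    and "\<alpha> > 0" and "\<alpha>top > 0"
    and "Zad \<noteq> {}" and "closed Zad" and "convex Zad"
    and "Aad \<noteq> {}" and "closedin (Euclidean_space m) Aad" and "Rn_convex Aad"
  shows "(\<exists>!(z, a). \<exists>\<sigma> u p h. optimal S J Zad Aad \<sigma> u p h z a) \<and>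
         (\<forall>z a. (\<exists>\<sigma> u p h. optimal S J Zad Aad \<sigma> u p h z a) \<longrightarrow>
                (\<exists>!(\<sigma>, u, p, h). S \<sigma> u p h z a))"
proof -
  interpret hc: hodge_control W V d k m B Ob R \<Pi>H G f yd rd \<pi>d c0 wy w\<sigma> w\<Pi> \<alpha> \<alpha>top
    by (rule hodge_control.intro) (use assms in blast)+
  show ?thesis
  proof (intro conjI allI impI)
    show "\<exists>!(z, a). \<exists>\<sigma> u p h. optimal S J Zad Aad \<sigma> u p h z a"
      \<comment> \<open>Reading \<open>(z, a)\<close> as one point turns optimality into minimality
        of \<open>reduced_cost\<close>; \<open>assms(18-23)\<close> are the conditions on the two
        admissible sets.\<close>
      using hc.ex1_reduced_minimizer[OF assms(18-23)]
      unfolding case_prod_unfold S_def J_def hc.optimal_iff prod.collapse .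
    fix z a
    obtain \<sigma> u p h where s: "S \<sigma> u p h z a"
      unfolding S_def using hc.state_exists by blast
    show "\<exists>!(\<sigma>, u, p, h). S \<sigma> u p h z a"
      by (rule ex1I[of _ "(\<sigma>, u, p, h)"]) (use s hc.state_unique in \<open>auto simp: S_def\<close>)
  qed
qed

end
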